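(* Let $r\ge2$ and let $n\ge0$ be an integer. For the inductive system of $\mathcal{G}_r$-modules $$\mathcal{V}(n\epsilon_1,0)\hookrightarrow\mathcal{V}((n+r)\epsilon_1,1)\otimes\delta_1\hookrightarrow\mathcal{V}((n+2r)\epsilon_1,2)\otimes\delta_2\hookrightarrow\cdots$$ there is an isomorphism of $\mathcal{G}_r$-modules $$\varinjlim_N\left(\mathcal{V}((n+Nr)\epsilon_1,N)\otimes\delta_N\right)\cong\mathcal{L}_n.$$
   Context: Deformed modules: $\mathbb{C}\langle\mathcal{X},\mathcal{Y}\rangle$ is the associative algebra generated by $\mathcal{X},\mathcal{Y}$ with $\mathcal{Y}\mathcal{X}-\mathcal{X}\mathcal{Y}=\mathcal{X}$, acting on $\mathbb{C}[x,x^{-1}]$ by $\mathcal{X}=x$, $\mathcal{Y}=xD$, $D=\partial/\partial x$. $\mathcal{G}_r=\mathfrak{gl}_r\otimes\mathbb{C}\langle\mathcal{X},\mathcal{Y}\rangle$ (Lie algebra of matrices with the commutator). $V_r=\mathbb{C}^r$ with basis $u_1,\dots,u_r$; $V_r^{(N)}=V_r\otimes(\mathbb{C}[x,x^{-1}]/x^N\mathbb{C}[x])$ is a $\mathcal{G}_r$-module with basis $u_j^i=u_j\otimes x^i$, $i<N$. For a partition $\xi=(\xi_1\ge\dots\ge\xi_r\ge0)$, $v_\xi^{(N)}=\bigwedge_{j=1}^r\bigwedge_{i=N-\xi_j}^{N-1}u_j^i$ and $\mathcal{V}(\xi,N)=U(\mathcal{G}_r)v_\xi^{(N)}\subset\bigwedge^{|\xi|}V_r^{(N)}$.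 Here $m\epsilon_1=(m,0,\dots,0)$. For $N\ge0$, $\delta_N$ is the one-dimensional $\mathcal{G}_r$-module dual to the top exterior power of $V_r\otimes(\mathbb{C}[x]/x^N\mathbb{C}[x])$, with generator also written $\delta_N$ (dual to $\bigwedge_{0\le i<N}\bigwedge_ju_j^i$). The maps of the system are the embeddings $u\otimes\delta_N\mapsto(u\wedge u_1^N\wedge\dots\wedge u_r^N)\otimes\delta_{N+1}$ (up to the sign fixed by ordering the wedge factors). Semi-infinite forms: for $H\subset\mathbb{Z}\times\{1,\dots,r\}$ whose symmetric difference with $\{i\ge0\}\times\{1,\dots,r\}$ is finite, let $u_H^{\infty/2}=\bigwedge_{(i,j)\in H}u_j^i$ with $u_j^i=u_j\otimes x^i\in V_r\otimes\mathbb{C}[x,x^{-1}]$; $\mathcal{L}$ is the space with basis these semi-infinite monomials. $\mathcal{G}_r$ acts on $\mathcal{L}$ as follows: an element $a$ acts on $V_r\otimes\mathbb{C}[x,x^{-1}]$; write its matrix in the basis $u_j^i$ as off-diagonal part plus diagonal part. The off-diagonal part acts on $\mathcal{L}$ by the Leibniz rule, and a diagonal operator $u_j^i\mapsto c_{ij}u_j^i$ acts on $u_H^{\infty/2}$ by the scalar $\sum_{(i,j)\in H,\,i<0}c_{ij}-\sum_{(i,j)\notin H,\,i\ge0}c_{ij}$. $\mathcal{L}_n\subset\mathcal{L}$ is the subspace on which $\mathrm{Id}\otimes1$ acts by the scalar $n$; it is a $\mathcal{G}_r$-submodule. *)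

theory Defs
  imports
    Complex_Main
    "HOL-Library.Poly_Mapping"
    "HOL-Library.Product_Lexorder"
    "Jordan_Normal_Form.VS_Connect"
begin

section \<open>Finitely supported functions as free vector spaces\<close>

text \<open>
  \<open>'a \<Rightarrow>\<^sub>0 complex\<close> is the complex vector space with basis \<open>'a\<close>; the basis vector of \<open>b\<close> is
  \<open>Poly_Mapping.single b 1\<close>.
\<close>

definition cscale :: "complex \<Rightarrow> ('a \<Rightarrow>\<^sub>0 complex) \<Rightarrow> ('a \<Rightarrow>\<^sub>0 complex)" where
  "cscale c f = Poly_Mapping.map ((*) c) f"

lemma lookup_cscale [simp]: "Poly_Mapping.lookup (cscale c f) k = c * Poly_Mapping.lookup f k"
  by (simp add: cscale_def Poly_Mapping.map.rep_eq when_def)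

global_interpretation pm: vector_space "cscale :: complex \<Rightarrow> ('a \<Rightarrow>\<^sub>0 complex) \<Rightarrow> ('a \<Rightarrow>\<^sub>0 complex)"
  by unfold_locales (rule poly_mapping_eqI, simp add: lookup_add algebra_simps)+


section \<open>The algebra \<open>\<complex>\<langle>X, Y\<rangle>\<close> with \<open>YX - XY = X\<close>\<close>

text \<open>
  The algebra is given by its presentation: terms over the two generators, modulo the congruence
  generated by the axioms of unital associative complex algebras and the defining relation.
\<close>

datatype xy_term =
    GenX
  | GenY
  | Const complex
  | Plus xy_term xy_term
  | Times xy_term xy_term

inductive xy_eq :: "xy_term \<Rightarrow> xy_term \<Rightarrow> bool" where
  refl: "xy_eq s s"
| sym: "xy_eq s t \<Longrightarrow> xy_eq t s"
| trans: "xy_eq s t \<Longrightarrow> xy_eq t u \<Longrightarrow> xy_eq s u"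
| cong_plus: "xy_eq s s' \<Longrightarrow> xy_eq t t' \<Longrightarrow> xy_eq (Plus s t) (Plus s' t')"
| cong_times: "xy_eq s s' \<Longrightarrow> xy_eq t t' \<Longrightarrow> xy_eq (Times s t) (Times s' t')"
| plus_assoc: "xy_eq (Plus (Plus s t) u) (Plus s (Plus t u))"
| plus_comm: "xy_eq (Plus s t) (Plus t s)"
| plus_zero: "xy_eq (Plus (Const 0) s) s"
| plus_neg: "xy_eq (Plus (Times (Const (-1)) s) s) (Const 0)"
| times_assoc: "xy_eq (Times (Times s t) u) (Times s (Times t u))"
| times_one: "xy_eq (Times (Const 1) s) s"
| distrib_right: "xy_eq (Times (Plus s t) u) (Plus (Times s u) (Times t u))"
| distrib_left: "xy_eq (Times s (Plus t u)) (Plus (Times s t) (Times s u))"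
| const_plus: "xy_eq (Plus (Const c) (Const d)) (Const (c + d))"
| const_times: "xy_eq (Times (Const c) (Const d)) (Const (c * d))"
| const_central: "xy_eq (Times (Const c) s) (Times s (Const c))"
| relation: "xy_eq (Times GenY GenX) (Plus (Times GenX GenY) GenX)"

quotient_type xy_alg = xy_term / xy_eq
  by (intro equivpI reflpI sympI transpI) (blast intro: xy_eq.intros)+


subsection \<open>Its action on Laurent polynomials\<close>

text \<open>
  \<open>\<complex>[x, x\<^sup>-\<^sup>1]\<close> is the group algebra \<open>int \<Rightarrow>\<^sub>0 complex\<close> of \<open>\<int>\<close>, in which \<open>x\<^sup>m\<close> is \<open>single m 1\<close> and
  multiplication is the one of \<open>Poly_Mapping\<close>.
\<close>

type_synonym laurent = "int \<Rightarrow>\<^sub>0 complex"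

definition laurent_deriv :: "laurent \<Rightarrow> laurent" where
  "laurent_deriv f = (\<Sum>m\<in>Poly_Mapping.keys f. Poly_Mapping.single (m - 1) (of_int m * Poly_Mapping.lookup f m))"

primrec xy_term_act :: "xy_term \<Rightarrow> laurent \<Rightarrow> laurent" where
  "xy_term_act GenX f = Poly_Mapping.single 1 1 * f"
| "xy_term_act GenY f = Poly_Mapping.single 1 1 * laurent_deriv f"
| "xy_term_act (Const c) f = cscale c f"
| "xy_term_act (Plus s t) f = xy_term_act s f + xy_term_act t f"
| "xy_term_act (Times s t) f = xy_term_act s (xy_term_act t f)"

lemma cscale_conv_mult: "cscale c f = Poly_Mapping.single 0 c * f"
  by (simp add: cscale_def mult_map_scale_conv_mult)

lemma lookup_laurent_deriv: "Poly_Mapping.lookup (laurent_deriv f) k = of_int (k + 1) * Poly_Mapping.lookup f (k + 1)"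
proof -
  have "Poly_Mapping.lookup (laurent_deriv f) k = (\<Sum>m\<in>Poly_Mapping.keys f. if m = k + 1 then of_int m * Poly_Mapping.lookup f m else 0)"
    unfolding laurent_deriv_def lookup_sum
    by (rule sum.cong) (auto simp: lookup_single when_def)
  also have "\<dots> = of_int (k + 1) * Poly_Mapping.lookup f (k + 1)"
    by (simp add: sum.delta in_keys_iff)
  finally show ?thesis .
qed

lemma lookup_X_times: "Poly_Mapping.lookup (Poly_Mapping.single (1 :: int) (1 :: complex) * f) k = Poly_Mapping.lookup f (k - 1)"
proof -
  have eq: "(k = 1 + q) = (q = k - 1)" for q :: int
    by auto
  show ?thesis
    by (simp add: lookup_mult lookup_single when_mult eq)
qed

lemma xy_term_act_add: "xy_term_act s (f + g) = xy_term_act s f + xy_term_act s g"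
proof (induction s arbitrary: f g)
  case GenX
  show ?case by (simp add: algebra_simps)
next
  case GenY
  show ?case
    by (rule poly_mapping_eqI) (simp add: lookup_X_times lookup_laurent_deriv lookup_add ring_distribs)
next
  case (Const c)
  show ?case by (simp add: pm.scale_right_distrib)
qed (simp_all add: algebra_simps)

lemma xy_term_act_cscale: "xy_term_act s (cscale c f) = cscale c (xy_term_act s f)"
proof (induction s arbitrary: f)
  case GenX
  show ?case by (rule poly_mapping_eqI) (simp add: lookup_X_times)
next
  case GenY
  show ?case by (rule poly_mapping_eqI) (simp add: lookup_X_times lookup_laurent_deriv)
next
  case (Const d)
  show ?case by (simp add: pm.scale_left_commute)
qed (simp_all add: pm.scale_right_distrib)

lemma xy_term_act_cong: "xy_eq s t \<Longrightarrow> xy_term_act s = xy_term_act t"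
proof (induction rule: xy_eq.induct)
  case relation
  show ?case
    by (intro ext poly_mapping_eqI)
      (simp add: lookup_X_times lookup_laurent_deriv lookup_add ring_distribs)
next
  case (plus_neg s)
  show ?case
    by (intro ext) (rule poly_mapping_eqI, simp add: lookup_add)
qed (auto simp: fun_eq_iff xy_term_act_add xy_term_act_cscale pm.scale_left_distrib add_ac)

lift_definition xy_act :: "xy_alg \<Rightarrow> laurent \<Rightarrow> laurent" is xy_term_act
  by (rule xy_term_act_cong)

lift_definition xy_X :: xy_alg is GenX .
lift_definition xy_Y :: xy_alg is GenY .
lift_definition xy_const :: "complex \<Rightarrow> xy_alg" is Const .

instantiation xy_alg :: ring_1
begin

lift_definition zero_xy_alg :: xy_alg is "Const 0" .
lift_definition one_xy_alg :: xy_alg is "Const 1" .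
lift_definition plus_xy_alg :: "xy_alg \<Rightarrow> xy_alg \<Rightarrow> xy_alg" is Plus
  by (rule xy_eq.cong_plus)
lift_definition times_xy_alg :: "xy_alg \<Rightarrow> xy_alg \<Rightarrow> xy_alg" is Times
  by (rule xy_eq.cong_times)
lift_definition uminus_xy_alg :: "xy_alg \<Rightarrow> xy_alg" is "Times (Const (-1))"
  by (intro xy_eq.cong_times xy_eq.refl)
definition minus_xy_alg :: "xy_alg \<Rightarrow> xy_alg \<Rightarrow> xy_alg" where
  "minus_xy_alg a b = a + - b"

instance
proof
  fix a b c :: xy_alg
  show "a + b + c = a + (b + c)" by transfer (rule xy_eq.plus_assoc)
  show "a + b = b + a" by transfer (rule xy_eq.plus_comm)
  show "0 + a = a" by transfer (rule xy_eq.plus_zero)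
  show "- a + a = 0" by transfer (rule xy_eq.plus_neg)
  show "a - b = a + - b" by (rule minus_xy_alg_def)
  show "a * b * c = a * (b * c)" by transfer (rule xy_eq.times_assoc)
  show "1 * a = a" by transfer (rule xy_eq.times_one)
  show "a * 1 = a"
    by transfer (rule xy_eq.trans[OF xy_eq.sym[OF xy_eq.const_central] xy_eq.times_one])
  show "(a + b) * c = a * c + b * c" by transfer (rule xy_eq.distrib_right)
  show "a * (b + c) = a * b + a * c" by transfer (rule xy_eq.distrib_left)
  show "(0 :: xy_alg) \<noteq> 1"
  proof
    assume "(0 :: xy_alg) = 1"
    then have "xy_eq (Const 0) (Const 1)"
      by transfer
    then have "Poly_Mapping.lookup (xy_term_act (Const 0) 1) 0 = Poly_Mapping.lookup (xy_term_act (Const 1) 1) 0"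
      using xy_term_act_cong by metis
    then show False by simp
  qed
qed

end

lemma xy_relation: "xy_Y * xy_X - xy_X * xy_Y = xy_X"
proof -
  have "xy_Y * xy_X = xy_X * xy_Y + xy_X"
    by transfer (rule xy_eq.relation)
  then show ?thesis by simp
qed


section \<open>The Lie algebra \<open>\<G>\<^sub>r\<close> and its modules\<close>

text \<open>
  \<open>gl\<^sub>r \<otimes> \<complex>\<langle>X, Y\<rangle>\<close> is realised as the \<open>r \<times> r\<close> matrices over \<open>xy_alg\<close> with the commutator. Matrix
  indices, and hence the indices of \<open>u\<^sub>1, \<dots>, u\<^sub>r\<close>, run from \<open>0\<close> to \<open>r - 1\<close>.
\<close>

type_synonym gr = "xy_alg mat"

abbreviation gr_carrier :: "nat \<Rightarrow> gr set" where
  "gr_carrier r \<equiv> carrier_mat r r"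

definition gr_bracket :: "gr \<Rightarrow> gr \<Rightarrow> gr" where
  "gr_bracket a b = a * b - b * a"

record 'b gr_module = "(complex, 'b) module" +
  act :: "gr \<Rightarrow> 'b \<Rightarrow> 'b"

definition is_gr_module :: "nat \<Rightarrow> 'b gr_module \<Rightarrow> bool" where
  "is_gr_module r M \<longleftrightarrow>
     Module.module class_ring M \<and>
     (\<forall>a\<in>gr_carrier r. \<forall>v\<in>carrier M. act M a v \<in> carrier M) \<and>
     (\<forall>a\<in>gr_carrier r. \<forall>v\<in>carrier M. \<forall>w\<in>carrier M.
        act M a (v \<oplus>\<^bsub>M\<^esub> w) = act M a v \<oplus>\<^bsub>M\<^esub> act M a w) \<and>
     (\<forall>a\<in>gr_carrier r. \<forall>c. \<forall>v\<in>carrier M. act M a (c \<odot>\<^bsub>M\<^esub> v) = c \<odot>\<^bsub>M\<^esub> act M a v) \<and>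
     (\<forall>a\<in>gr_carrier r. \<forall>b\<in>gr_carrier r. \<forall>v\<in>carrier M.
        act M (a + b) v = act M a v \<oplus>\<^bsub>M\<^esub> act M b v) \<and>
     (\<forall>a\<in>gr_carrier r. \<forall>c. \<forall>v\<in>carrier M. act M (xy_const c \<cdot>\<^sub>m a) v = c \<odot>\<^bsub>M\<^esub> act M a v) \<and>
     (\<forall>a\<in>gr_carrier r. \<forall>b\<in>gr_carrier r. \<forall>v\<in>carrier M.
        act M (gr_bracket a b) v = act M a (act M b v) \<ominus>\<^bsub>M\<^esub> act M b (act M a v))"

definition gr_hom :: "nat \<Rightarrow> 'b gr_module \<Rightarrow> 'c gr_module \<Rightarrow> ('b \<Rightarrow> 'c) set" where
  "gr_hom r M M' =
     {\<phi>. (\<forall>v\<in>carrier M. \<phi> v \<in> carrier M') \<and>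
         (\<forall>v\<in>carrier M. \<forall>w\<in>carrier M. \<phi> (v \<oplus>\<^bsub>M\<^esub> w) = \<phi> v \<oplus>\<^bsub>M'\<^esub> \<phi> w) \<and>
         (\<forall>c. \<forall>v\<in>carrier M. \<phi> (c \<odot>\<^bsub>M\<^esub> v) = c \<odot>\<^bsub>M'\<^esub> \<phi> v) \<and>
         (\<forall>a\<in>gr_carrier r. \<forall>v\<in>carrier M. \<phi> (act M a v) = act M' a (\<phi> v))}"

definition gr_isomorphic :: "nat \<Rightarrow> 'b gr_module \<Rightarrow> 'c gr_module \<Rightarrow> bool" where
  "gr_isomorphic r M M' \<longleftrightarrow>
     is_gr_module r M \<and> is_gr_module r M' \<and>
     (\<exists>\<phi>\<in>gr_hom r M M'. bij_betw \<phi> (carrier M) (carrier M'))"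

text \<open>Modules whose underlying vector space is a subspace of a free vector space; the ring fields
  \<open>mult\<close> and \<open>one\<close> of the record are irrelevant.\<close>

definition free_gr_module ::
    "('a \<Rightarrow>\<^sub>0 complex) set \<Rightarrow> (gr \<Rightarrow> ('a \<Rightarrow>\<^sub>0 complex) \<Rightarrow> ('a \<Rightarrow>\<^sub>0 complex)) \<Rightarrow> ('a \<Rightarrow>\<^sub>0 complex) gr_module" where
  "free_gr_module W \<rho> =
     \<lparr>carrier = W, mult = undefined, one = undefined, zero = 0, add = (+), smult = cscale, act = \<rho>\<rparr>"


subsection \<open>Inductive systems and their direct limits\<close>

definition inductive_system :: "nat \<Rightarrow> (nat \<Rightarrow> 'b gr_module) \<Rightarrow> (nat \<Rightarrow> 'b \<Rightarrow> 'b) \<Rightarrow> bool" where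
  "inductive_system r M f \<longleftrightarrow>
     (\<forall>N. is_gr_module r (M N)) \<and>
     (\<forall>N. f N \<in> gr_hom r (M N) (M (Suc N)) \<and> inj_on (f N) (carrier (M N)))"

text \<open>\<open>sys_map f N k\<close> is the composite \<open>f (N + k - 1) \<circ> \<dots> \<circ> f N\<close> from stage \<open>N\<close> to stage \<open>N + k\<close>.\<close>

primrec sys_map :: "(nat \<Rightarrow> 'b \<Rightarrow> 'b) \<Rightarrow> nat \<Rightarrow> nat \<Rightarrow> 'b \<Rightarrow> 'b" where
  "sys_map f N 0 = id"
| "sys_map f N (Suc k) = f (N + k) \<circ> sys_map f N k"

definition dl_points :: "(nat \<Rightarrow> 'b gr_module) \<Rightarrow> (nat \<times> 'b) set" where
  "dl_points M = (SIGMA N:UNIV. carrier (M N))"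

definition dl_rel :: "(nat \<Rightarrow> 'b gr_module) \<Rightarrow> (nat \<Rightarrow> 'b \<Rightarrow> 'b) \<Rightarrow> ((nat \<times> 'b) \<times> (nat \<times> 'b)) set" where
  "dl_rel M f = {((N, v), (K, w)). (N, v) \<in> dl_points M \<and> (K, w) \<in> dl_points M \<and>
     (\<exists>k l. N + k = K + l \<and> sys_map f N k v = sys_map f K l w)}"

text \<open>The operations on classes are computed on representatives (at a common stage, for the sum);
  the unions below are unions of one and the same class.\<close>

definition direct_limit :: "(nat \<Rightarrow> 'b gr_module) \<Rightarrow> (nat \<Rightarrow> 'b \<Rightarrow> 'b) \<Rightarrow> (nat \<times> 'b) set gr_module" where
  "direct_limit M f =
     \<lparr>carrier = dl_points M // dl_rel M f,
      mult = undefined,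
      one = undefined,
      zero = dl_rel M f `` {(0, \<zero>\<^bsub>M 0\<^esub>)},
      add = (\<lambda>A B. \<Union>{dl_rel M f `` {(N, v \<oplus>\<^bsub>M N\<^esub> w)} | N v w. (N, v) \<in> A \<and> (N, w) \<in> B}),
      smult = (\<lambda>c A. \<Union>{dl_rel M f `` {(N, c \<odot>\<^bsub>M N\<^esub> v)} | N v. (N, v) \<in> A}),
      act = (\<lambda>a A. \<Union>{dl_rel M f `` {(N, act (M N) a v)} | N v. (N, v) \<in> A})\<rparr>"


section \<open>Action on \<open>V\<^sub>r \<otimes> \<complex>[x, x\<^sup>-\<^sup>1]\<close>\<close>

text \<open>The basis vector \<open>u\<^sub>j\<^sup>i = u\<^sub>j \<otimes> x\<^sup>i\<close> is indexed by the pair \<open>(i, j)\<close>; pairs are ordered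
  lexicographically.\<close>

type_synonym idx = "int \<times> nat"

definition vact :: "gr \<Rightarrow> idx \<Rightarrow> (idx \<Rightarrow>\<^sub>0 complex)" where
  "vact a p =
     (\<Sum>j<dim_row a.
        let h = xy_act (a $$ (j, snd p)) (Poly_Mapping.single (fst p) 1)
        in \<Sum>m\<in>Poly_Mapping.keys h. Poly_Mapping.single (m, j) (Poly_Mapping.lookup h m))"

definition mcoef :: "gr \<Rightarrow> idx \<Rightarrow> idx \<Rightarrow> complex" where
  "mcoef a q p = Poly_Mapping.lookup (vact a p) q"


section \<open>Exterior powers of \<open>V\<^sub>r\<^sup>(\<^sup>N\<^sup>)\<close>\<close>

text \<open>
  The exterior algebra of a space with a linearly ordered basis has as basis the wedge monomials
  \<open>p\<^sub>1 \<and> \<dots> \<and> p\<^sub>k\<close> with \<open>p\<^sub>1 < \<dots> < p\<^sub>k\<close>, indexed by the finite sets \<open>{p\<^sub>1, \<dots>, p\<^sub>k}\<close>. The sign in the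
  product counts the transpositions needed to sort the concatenated monomial.
\<close>

type_synonym ext = "idx set \<Rightarrow>\<^sub>0 complex"

definition wedge_mono :: "idx set \<Rightarrow> idx set \<Rightarrow> ext" where
  "wedge_mono S T =
     (if S \<inter> T = {}
      then Poly_Mapping.single (S \<union> T) ((-1) ^ card {(s, t). s \<in> S \<and> t \<in> T \<and> t < s})
      else 0)"

definition wedge :: "ext \<Rightarrow> ext \<Rightarrow> ext" where
  "wedge f g = (\<Sum>S\<in>Poly_Mapping.keys f. \<Sum>T\<in>Poly_Mapping.keys g. cscale (Poly_Mapping.lookup f S * Poly_Mapping.lookup g T) (wedge_mono S T))"

definition wedge_list :: "ext list \<Rightarrow> ext" where
  "wedge_list vs = foldr wedge vs (Poly_Mapping.single {} 1)"

definition ugen :: "idx \<Rightarrow> ext" where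
  "ugen p = Poly_Mapping.single {p} 1"

text \<open>
  \<open>V\<^sub>r\<^sup>(\<^sup>N\<^sup>) = V\<^sub>r \<otimes> (\<complex>[x, x\<^sup>-\<^sup>1] / x\<^sup>N \<complex>[x])\<close> has the basis \<open>u\<^sub>j\<^sup>i\<close> with \<open>i < N\<close>; in it, \<open>u\<^sub>j\<^sup>i = 0\<close> for
  \<open>i \<ge> N\<close>. The next definition is the action on a basis vector, as an element of the first exterior
  power.
\<close>

definition vact_trunc :: "int \<Rightarrow> gr \<Rightarrow> idx \<Rightarrow> ext" where
  "vact_trunc N a p = (\<Sum>q\<in>{q\<in>Poly_Mapping.keys (vact a p). fst q < N}. cscale (mcoef a q p) (ugen q))"

text \<open>Leibniz rule: one factor at a time is replaced by its image.\<close>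

definition ext_act_mono :: "int \<Rightarrow> gr \<Rightarrow> idx set \<Rightarrow> ext" where
  "ext_act_mono N a S =
     (let ps = sorted_list_of_set S
      in \<Sum>k<length ps. wedge_list ((map ugen ps)[k := vact_trunc N a (ps ! k)]))"

definition ext_act :: "int \<Rightarrow> gr \<Rightarrow> ext \<Rightarrow> ext" where
  "ext_act N a f = (\<Sum>S\<in>Poly_Mapping.keys f. cscale (Poly_Mapping.lookup f S) (ext_act_mono N a S))"


subsection \<open>The modules \<open>\<V>(\<xi>, N)\<close>\<close>

text \<open>A partition is given by its list of \<open>r\<close> parts.\<close>

definition v_vec :: "nat \<Rightarrow> nat list \<Rightarrow> int \<Rightarrow> ext" where
  "v_vec r \<xi> N =
     wedge_list (concat (map (\<lambda>j. map (\<lambda>i. ugen (i, j)) [N - int (\<xi> ! j)..N - 1]) [0..<r]))"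

text \<open>\<open>U(\<G>\<^sub>r) v\<close> is spanned by the vectors \<open>a\<^sub>1 (\<dots> (a\<^sub>k v))\<close> with \<open>a\<^sub>1, \<dots>, a\<^sub>k\<close> in \<open>\<G>\<^sub>r\<close>.\<close>

definition cyclic_span ::
    "nat \<Rightarrow> (gr \<Rightarrow> ('a \<Rightarrow>\<^sub>0 complex) \<Rightarrow> ('a \<Rightarrow>\<^sub>0 complex)) \<Rightarrow> ('a \<Rightarrow>\<^sub>0 complex) \<Rightarrow> ('a \<Rightarrow>\<^sub>0 complex) set" where
  "cyclic_span r \<rho> v = pm.span {foldr \<rho> as v | as. set as \<subseteq> gr_carrier r}"

definition V_module :: "nat \<Rightarrow> nat list \<Rightarrow> int \<Rightarrow> ext gr_module" where
  "V_module r \<xi> N = free_gr_module (cyclic_span r (ext_act N) (v_vec r \<xi> N)) (ext_act N)"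

definition eps1_times :: "nat \<Rightarrow> nat \<Rightarrow> nat list" where
  "eps1_times r m = m # replicate (r - 1) 0"


subsection \<open>The one-dimensional modules \<open>\<delta>\<^sub>N\<close>\<close>

text \<open>
  \<open>V\<^sub>r \<otimes> (\<complex>[x] / x\<^sup>N \<complex>[x])\<close> is the submodule of \<open>V\<^sub>r\<^sup>(\<^sup>N\<^sup>)\<close> with basis \<open>u\<^sub>j\<^sup>i\<close>, \<open>0 \<le> i < N\<close>. Its top exterior
  power is the line spanned by the wedge of all these vectors, on which \<open>a\<close> acts by the scalar
  \<open>top_char r N a\<close>; hence \<open>a\<close> acts on the dual line \<open>\<delta>\<^sub>N\<close> by \<open>- top_char r N a\<close>.
\<close>

definition top_set :: "nat \<Rightarrow> nat \<Rightarrow> idx set" where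
  "top_set r N = {0..<int N} \<times> {..<r}"

definition top_char :: "nat \<Rightarrow> nat \<Rightarrow> gr \<Rightarrow> complex" where
  "top_char r N a =
     Poly_Mapping.lookup (ext_act (int N) a (Poly_Mapping.single (top_set r N) 1)) (top_set r N)"

text \<open>\<open>M \<otimes> \<delta>\<^sub>N\<close>, with \<open>u \<otimes> \<delta>\<^sub>N\<close> written as \<open>u\<close>:
  \<open>a (u \<otimes> \<delta>\<^sub>N) = a u \<otimes> \<delta>\<^sub>N + u \<otimes> a \<delta>\<^sub>N\<close>.\<close>

definition tensor_delta :: "nat \<Rightarrow> nat \<Rightarrow> ('a \<Rightarrow>\<^sub>0 complex) gr_module \<Rightarrow> ('a \<Rightarrow>\<^sub>0 complex) gr_module" where
  "tensor_delta r N M = M\<lparr>act := (\<lambda>a u. act M a u + cscale (- top_char r N a) u)\<rparr>"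


subsection \<open>The inductive system\<close>

definition V_system :: "nat \<Rightarrow> nat \<Rightarrow> nat \<Rightarrow> ext gr_module" where
  "V_system r n N = tensor_delta r N (V_module r (eps1_times r (n + N * r)) (int N))"

text \<open>\<open>u \<otimes> \<delta>\<^sub>N \<mapsto> (u \<and> u\<^sub>1\<^sup>N \<and> \<dots> \<and> u\<^sub>r\<^sup>N) \<otimes> \<delta>\<^sub>N\<^sub>+\<^sub>1\<close>\<close>

definition V_embed :: "nat \<Rightarrow> nat \<Rightarrow> ext \<Rightarrow> ext" where
  "V_embed r N u = wedge u (wedge_list (map (\<lambda>j. ugen (int N, j)) [0..<r]))"


section \<open>Semi-infinite forms\<close>

text \<open>
  The monomial \<open>u\<^sub>H\<^sup>\<infinity>\<^sup>/\<^sup>2\<close>, whose factors are taken in increasing lexicographic order, is the basis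
  vector of the (infinite) set \<open>H\<close>.
\<close>

type_synonym semi = "idx set \<Rightarrow>\<^sub>0 complex"

definition semi_admissible :: "nat \<Rightarrow> idx set \<Rightarrow> bool" where
  "semi_admissible r H \<longleftrightarrow>
     H \<subseteq> UNIV \<times> {..<r} \<and> finite (sym_diff H ({0..} \<times> {..<r}))"

text \<open>The monomial of \<open>H\<close> with the factor \<open>p \<in> H\<close> replaced by \<open>q \<noteq> p\<close>: it vanishes if \<open>q\<close> is already a
  factor, and otherwise \<open>q\<close> is moved to its place past the factors between \<open>p\<close> and \<open>q\<close>.\<close>

definition semi_replace :: "idx set \<Rightarrow> idx \<Rightarrow> idx \<Rightarrow> semi" where
  "semi_replace H p q =
     (if q \<in> H then 0
      else Poly_Mapping.single (insert q (H - {p}))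
             ((-1) ^ card {h\<in>H. min p q < h \<and> h < max p q}))"

definition semi_diag :: "nat \<Rightarrow> gr \<Rightarrow> idx set \<Rightarrow> complex" where
  "semi_diag r a H =
     (\<Sum>p\<in>{p\<in>H. fst p < 0}. mcoef a p p) - (\<Sum>p\<in>({0..} \<times> {..<r}) - H. mcoef a p p)"

text \<open>In the Leibniz sum only the pairs with \<open>q \<notin> H\<close> contribute; for admissible \<open>H\<close> there are finitely
  many of them with a nonzero coefficient, as every \<open>a\<close> raises \<open>i\<close> by a bounded non-negative amount.\<close>

definition semi_act_mono :: "nat \<Rightarrow> gr \<Rightarrow> idx set \<Rightarrow> semi" where
  "semi_act_mono r a H =
     (\<Sum>(p, q)\<in>{(p, q). p \<in> H \<and> q \<noteq> p \<and> q \<notin> H \<and> mcoef a q p \<noteq> 0}.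
        cscale (mcoef a q p) (semi_replace H p q))
     + cscale (semi_diag r a H) (Poly_Mapping.single H 1)"

definition semi_act :: "nat \<Rightarrow> gr \<Rightarrow> semi \<Rightarrow> semi" where
  "semi_act r a f = (\<Sum>H\<in>Poly_Mapping.keys f. cscale (Poly_Mapping.lookup f H) (semi_act_mono r a H))"

definition semi_space :: "nat \<Rightarrow> semi set" where
  "semi_space r = {f. \<forall>H\<in>Poly_Mapping.keys f. semi_admissible r H}"

text \<open>\<open>1\<^sub>m r\<close> is the element \<open>Id \<otimes> 1\<close> of \<open>\<G>\<^sub>r\<close>.\<close>

definition L_module :: "nat \<Rightarrow> int \<Rightarrow> semi gr_module" where
  "L_module r n =
     free_gr_module {f\<in>semi_space r. semi_act r (1\<^sub>m r) f = cscale (of_int n) f} (semi_act r)"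

end

theory Submission
  imports Defs
begin

text \<open>
  Fill up a wedge monomial \<open>u\<^sub>S\<close> of stage \<open>N\<close>, whose factors \<open>u\<^sub>j\<^sup>i\<close> all have \<open>i < N\<close>, with all the factors
  of degree at least \<open>N\<close>. The resulting maps from the stages to semi-infinite forms (\<open>fill_sea\<close>) are
  injective, and the embeddings of the system are made so that they are compatible. They also
  intertwine the actions. No element of \<open>\<G>\<^sub>r\<close> lowers the degree, so a factor of the sea can
  only be moved onto an occupied place, which gives zero; so does raising a factor of \<open>u\<^sub>S\<close> to degree \<open>N\<close>
  or more, and this is zero in the truncated module as well. The diagonal part is regularised on
  semi-infinite forms by subtracting the trace over \<open>0 \<le> i < N\<close>, which is what tensoring with \<open>\<delta>\<^sub>N\<close>
  does. The direct limit is therefore the union of the images of the stages, and it remains to see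
  that they exhaust \<open>\<L>\<^sub>n\<close>
  (\<open>direct_limit_isomorphic\<close>, \<open>L_space_exhausted\<close>).

  Each vector of a stage lives in the exterior algebra over a finite window of indices, and there
  \<open>a\<close> acts as \<open>\<Sum> a\<^sub>q\<^sub>p \<psi>\<^sub>q \<psi>\<^sub>p\<^sup>*\<close> in terms of fermionic creation and annihilation operators. The canonical
  anticommutation relations give both the Leibniz formula and the bracket relation. Windows are
  compatible with products because degrees only go up. Pushing the relations along \<open>fill_sea\<close> shows
  that \<open>\<L>\<^sub>n\<close> is a module too.

  The cyclic submodule is large for the following reason. The element \<open>E\<^sub>l\<^sub>j \<otimes> X\<^sup>k f(Y)\<close> sends \<open>u\<^sub>j\<^sup>i\<close> to
  \<open>f(i) u\<^sub>l\<^sup>i\<^sup>+\<^sup>k\<close>. On one monomial only finitely many \<open>i\<close> matter, so \<open>f\<close> can be chosen to vanish at all of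
  them but one; then a single factor is moved, and all the others are killed (\<open>move_factor\<close>). Such
  moves lead from the generating monomial to every monomial that dominates it, in the sense that
  above every degree it has at least as many factors (\<open>dominated_induct\<close>). The generator occupies
  one row only, while a given semi-infinite monomial occupies all \<open>r\<close> rows from some degree on. Since
  \<open>r \<ge> 2\<close>, it wins the count once \<open>N\<close> is large (\<open>generator_set_dominated\<close>). The same counting shows
  that the embeddings map one cyclic submodule into the next (\<open>generator_set_level_dominated\<close>).
\<close>

section \<open>Linear extensions and supports\<close>

definition lin_ext :: "('a \<Rightarrow> ('b \<Rightarrow>\<^sub>0 complex)) \<Rightarrow> ('a \<Rightarrow>\<^sub>0 complex) \<Rightarrow> ('b \<Rightarrow>\<^sub>0 complex)" where
  "lin_ext F f = (\<Sum>S\<in>Poly_Mapping.keys f. cscale (Poly_Mapping.lookup f S) (F S))"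

lemma lin_ext_superset:
  assumes "finite K" "Poly_Mapping.keys f \<subseteq> K"
  shows "lin_ext F f = (\<Sum>S\<in>K. cscale (Poly_Mapping.lookup f S) (F S))"
  unfolding lin_ext_def
  by (rule sum.mono_neutral_left) (use assms in \<open>auto simp: in_keys_iff\<close>)

lemma lin_ext_add: "lin_ext F (f + g) = lin_ext F f + lin_ext F g"
proof -
  let ?K = "Poly_Mapping.keys f \<union> Poly_Mapping.keys g"
  have "Poly_Mapping.keys (f + g) \<subseteq> ?K" by (rule Poly_Mapping.keys_add)
  then show ?thesis
    by (simp add: lin_ext_superset[of ?K] lookup_add pm.scale_left_distrib sum.distrib)
qed

lemma keys_cscale_subset: "Poly_Mapping.keys (cscale c f) \<subseteq> Poly_Mapping.keys f"
  by (auto simp: in_keys_iff)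

lemma lin_ext_cscale: "lin_ext F (cscale c f) = cscale c (lin_ext F f)"
proof -
  have "lin_ext F (cscale c f) = (\<Sum>S\<in>Poly_Mapping.keys f. cscale (Poly_Mapping.lookup (cscale c f) S) (F S))"
    by (rule lin_ext_superset) (simp_all add: keys_cscale_subset)
  then show ?thesis
    by (simp add: lin_ext_def pm.scale_sum_right)
qed

lemma lin_ext_zero [simp]: "lin_ext F 0 = 0"
  by (simp add: lin_ext_def)

lemma cscale_single [simp]: "cscale c (Poly_Mapping.single S d) = Poly_Mapping.single S (c * d)"
  by (rule poly_mapping_eqI) (simp add: lookup_single when_def)

lemma lin_ext_single [simp]: "lin_ext F (Poly_Mapping.single S c) = cscale c (F S)"
  by (cases "c = 0") (simp_all add: lin_ext_def)

lemma lin_ext_uminus: "lin_ext F (- f) = - lin_ext F f"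
  using lin_ext_cscale[of F "- 1" f] by simp

lemma lin_ext_diff: "lin_ext F (f - g) = lin_ext F f - lin_ext F g"
  using lin_ext_add[of F f "- g"] by (simp add: lin_ext_uminus)

lemma lin_ext_sum: "lin_ext F (sum g I) = (\<Sum>i\<in>I. lin_ext F (g i))"
  by (induction I rule: infinite_finite_induct) (simp_all add: lin_ext_add)

lemma lin_ext_cong: "(\<And>S. S \<in> Poly_Mapping.keys f \<Longrightarrow> F S = G S) \<Longrightarrow> lin_ext F f = lin_ext G f"
  by (simp add: lin_ext_def)

lemma lin_ext_compose: "lin_ext F (lin_ext G f) = lin_ext (\<lambda>S. lin_ext F (G S)) f"
  by (simp add: lin_ext_def[of _ f] lin_ext_sum lin_ext_cscale)

lemma lin_ext_basis_id: "lin_ext (\<lambda>S. Poly_Mapping.single S 1) f = f"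
  by (rule poly_mapping_eqI)
    (simp add: lin_ext_def lookup_sum lookup_single when_def in_keys_iff if_distrib sum.delta cong: if_cong)

lemma lin_ext_plus_fun: "lin_ext (\<lambda>S. F S + G S) f = lin_ext F f + lin_ext G f"
  by (simp add: lin_ext_def pm.scale_right_distrib sum.distrib)

lemma lin_ext_cscale_fun: "lin_ext (\<lambda>S. cscale c (F S)) f = cscale c (lin_ext F f)"
  by (simp add: lin_ext_def pm.scale_sum_right pm.scale_left_commute mult.commute)

lemma lin_ext_diff_fun: "lin_ext (\<lambda>S. F S - G S) f = lin_ext F f - lin_ext G f"
  by (simp add: lin_ext_def pm.scale_right_diff_distrib sum_subtractf)

lemma lin_ext_sum_fun: "lin_ext (\<lambda>S. \<Sum>i\<in>I. F i S) f = (\<Sum>i\<in>I. lin_ext (F i) f)"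
  by (simp add: lin_ext_def pm.scale_sum_right sum.swap[of _ I])

definition free_span :: "'a set \<Rightarrow> ('a \<Rightarrow>\<^sub>0 complex) set" where
  "free_span B = {f. Poly_Mapping.keys f \<subseteq> B}"

abbreviation fock :: "'a set \<Rightarrow> ('a set \<Rightarrow>\<^sub>0 complex) set" where
  "fock W \<equiv> free_span (Pow W)"

lemma free_span_zero [simp]: "0 \<in> free_span B"
  by (simp add: free_span_def)

lemma free_span_add: "f \<in> free_span B \<Longrightarrow> g \<in> free_span B \<Longrightarrow> f + g \<in> free_span B"
  using Poly_Mapping.keys_add[of f g] by (auto simp: free_span_def)

lemma free_span_cscale: "f \<in> free_span B \<Longrightarrow> cscale c f \<in> free_span B"
  using keys_cscale_subset[of c f] by (auto simp: free_span_def)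

lemma free_span_diff: "f \<in> free_span B \<Longrightarrow> g \<in> free_span B \<Longrightarrow> f - g \<in> free_span B"
  using free_span_add[of f B "cscale (-1) g"] free_span_cscale[of g B "-1"] by simp

lemma free_span_sum: "(\<And>i. i \<in> I \<Longrightarrow> g i \<in> free_span B) \<Longrightarrow> sum g I \<in> free_span B"
  by (induction I rule: infinite_finite_induct) (simp_all add: free_span_add)

lemma free_span_single: "S \<in> B \<Longrightarrow> Poly_Mapping.single S c \<in> free_span B"
  by (simp add: free_span_def)

lemma free_span_lin: "(\<And>S. S \<in> Poly_Mapping.keys f \<Longrightarrow> F S \<in> free_span B) \<Longrightarrow> lin_ext F f \<in> free_span B"
  unfolding lin_ext_def by (intro free_span_sum free_span_cscale)

lemma free_span_mono: "B \<subseteq> B' \<Longrightarrow> free_span B \<subseteq> free_span B'"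
  by (auto simp: free_span_def)

section \<open>Creation and annihilation operators\<close>

text \<open>
  The sign of moving \<open>p\<close> past the smaller factors of \<open>u\<^sub>S\<close> to its place; the cardinality is meaningful
  for finite \<open>S\<close> only, which is why the relations below are restricted to a finite window \<open>W\<close>.
\<close>

definition inv_sign :: "'a::linorder \<Rightarrow> 'a set \<Rightarrow> complex" where
  "inv_sign p S = (-1) ^ card {s\<in>S. s < p}"

lemma inv_sign_insert:
  assumes "finite S" "q \<notin> S"
  shows "inv_sign p (insert q S) = (if q < p then - inv_sign p S else inv_sign p S)"
proof -
  have "{s \<in> insert q S. s < p} = (if q < p then insert q {s\<in>S. s < p} else {s\<in>S. s < p})"
    by auto
  then show ?thesis using assms by (simp add: inv_sign_def)
qed

lemma inv_sign_remove:
  assumes "finite S" "q \<in> S"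
  shows "inv_sign p (S - {q}) = (if q < p then - inv_sign p S else inv_sign p S)"
  using inv_sign_insert[of "S - {q}" q p] assms by (simp add: insert_absorb split: if_splits)

lemma inv_sign_square [simp]: "inv_sign p S * inv_sign p S = 1"
  by (simp add: inv_sign_def flip: power_mult_distrib)

definition create :: "'a::linorder \<Rightarrow> ('a set \<Rightarrow>\<^sub>0 complex) \<Rightarrow> ('a set \<Rightarrow>\<^sub>0 complex)" where
  "create q = lin_ext (\<lambda>S. if q \<in> S then 0 else Poly_Mapping.single (insert q S) (inv_sign q S))"

definition annih :: "'a::linorder \<Rightarrow> ('a set \<Rightarrow>\<^sub>0 complex) \<Rightarrow> ('a set \<Rightarrow>\<^sub>0 complex)" where
  "annih p = lin_ext (\<lambda>S. if p \<in> S then Poly_Mapping.single (S - {p}) (inv_sign p S) else 0)"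

lemma create_single:
  "create q (Poly_Mapping.single S c) = (if q \<in> S then 0 else Poly_Mapping.single (insert q S) (c * inv_sign q S))"
  by (simp add: create_def)

lemma annih_single:
  "annih p (Poly_Mapping.single S c) = (if p \<in> S then Poly_Mapping.single (S - {p}) (c * inv_sign p S) else 0)"
  by (simp add: annih_def)

lemma create_linear:
  "create q 0 = 0" "create q (f + g) = create q f + create q g" "create q (f - g) = create q f - create q g"
  "create q (- f) = - create q f" "create q (cscale c f) = cscale c (create q f)"
  "create q (sum h I) = (\<Sum>i\<in>I. create q (h i))"
  by (simp_all add: create_def lin_ext_add lin_ext_diff lin_ext_uminus lin_ext_cscale lin_ext_sum)

lemma annih_linear:
  "annih q 0 = 0" "annih q (f + g) = annih q f + annih q g" "annih q (f - g) = annih q f - annih q g"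
  "annih q (- f) = - annih q f" "annih q (cscale c f) = cscale c (annih q f)"
  "annih q (sum h I) = (\<Sum>i\<in>I. annih q (h i))"
  by (simp_all add: annih_def lin_ext_add lin_ext_diff lin_ext_uminus lin_ext_cscale lin_ext_sum)

lemma create_fock: "f \<in> fock W \<Longrightarrow> q \<in> W \<Longrightarrow> create q f \<in> fock W"
  unfolding create_def by (rule free_span_lin) (auto simp: free_span_def)

lemma annih_fock: "f \<in> fock W \<Longrightarrow> annih q f \<in> fock W"
  unfolding annih_def by (rule free_span_lin) (auto simp: free_span_def)

lemma single_neg: "Poly_Mapping.single S (- c) = - Poly_Mapping.single S (c::complex)"
  by (rule poly_mapping_eqI) (simp add: lookup_single when_def)

text \<open>
  The canonical anticommutation relations, in this and the next two lemmas: on monomials, exchanging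
  the operators of two different indices changes exactly one of the two signs.
\<close>

lemma annih_create:
  assumes "finite W" "f \<in> fock W"
  shows "annih p (create q f) = (if p = q then f else 0) - create q (annih p f)"
proof -
  have "annih p (create q f) = lin_ext (\<lambda>S. annih p (create q (Poly_Mapping.single S 1))) f"
    by (simp add: annih_def create_def lin_ext_compose)
  also have "\<dots> = lin_ext (\<lambda>S. (if p = q then Poly_Mapping.single S 1 else 0) - create q (annih p (Poly_Mapping.single S 1))) f"
  proof (rule lin_ext_cong)
    fix S assume "S \<in> Poly_Mapping.keys f"
    then have "finite S" using assms by (auto simp: free_span_def intro: finite_subset)
    then show "annih p (create q (Poly_Mapping.single S 1)) =
        (if p = q then Poly_Mapping.single S 1 else 0) - create q (annih p (Poly_Mapping.single S 1))"
      by (auto simp: create_single annih_single create_linear annih_linear inv_sign_insert inv_sign_remove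
          insert_absorb insert_Diff_if single_neg mult.commute)
  qed
  also have "\<dots> = (if p = q then f else 0) - create q (annih p f)"
    by (simp add: lin_ext_diff_fun lin_ext_basis_id annih_def create_def lin_ext_compose flip: lin_ext_def) (simp add: lin_ext_def)
  finally show ?thesis .
qed

lemma create_create:
  assumes "finite W" "f \<in> fock W"
  shows "create p (create q f) = - create q (create p f)"
proof -
  have "create p (create q f) = lin_ext (\<lambda>S. create p (create q (Poly_Mapping.single S 1))) f"
    by (simp add: create_def lin_ext_compose)
  also have "\<dots> = lin_ext (\<lambda>S. cscale (-1) (create q (create p (Poly_Mapping.single S 1)))) f"
  proof (rule lin_ext_cong)
    fix S assume "S \<in> Poly_Mapping.keys f"
    then have "finite S" using assms by (auto simp: free_span_def intro: finite_subset)
    then show "create p (create q (Poly_Mapping.single S 1)) = cscale (-1) (create q (create p (Poly_Mapping.single S 1)))"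
      by (auto simp: create_single create_linear inv_sign_insert insert_commute single_neg mult.commute)
  qed
  also have "\<dots> = - create q (create p f)"
    unfolding lin_ext_cscale_fun by (simp add: create_def lin_ext_compose)
  finally show ?thesis .
qed

lemma annih_annih:
  assumes "finite W" "f \<in> fock W"
  shows "annih p (annih q f) = - annih q (annih p f)"
proof -
  have "annih p (annih q f) = lin_ext (\<lambda>S. annih p (annih q (Poly_Mapping.single S 1))) f"
    by (simp add: annih_def lin_ext_compose)
  also have "\<dots> = lin_ext (\<lambda>S. cscale (-1) (annih q (annih p (Poly_Mapping.single S 1)))) f"
  proof (rule lin_ext_cong)
    fix S assume "S \<in> Poly_Mapping.keys f"
    then have "finite S" using assms by (auto simp: free_span_def intro: finite_subset)
    then show "annih p (annih q (Poly_Mapping.single S 1)) = cscale (-1) (annih q (annih p (Poly_Mapping.single S 1)))"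
      by (cases "p = q"; cases "p < q")
        (auto simp: annih_single annih_linear inv_sign_remove single_neg mult.commute insert_commute
          Diff_insert2[symmetric])
  qed
  also have "\<dots> = - annih q (annih p f)"
    unfolding lin_ext_cscale_fun by (simp add: annih_def lin_ext_compose)
  finally show ?thesis .
qed

section \<open>Second quantization of matrices\<close>

text \<open>
  For a matrix \<open>A\<close> on the span of \<open>W\<close>, this is the derivation of the exterior algebra extending \<open>A\<close>
  (\<open>second_quant_create\<close> and \<open>second_quant_foldr_create\<close> below).
\<close>

definition second_quant :: "'a::linorder set \<Rightarrow> ('a \<Rightarrow> 'a \<Rightarrow> complex) \<Rightarrow> ('a set \<Rightarrow>\<^sub>0 complex) \<Rightarrow> ('a set \<Rightarrow>\<^sub>0 complex)" where
  "second_quant W A f = (\<Sum>(q, p)\<in>W \<times> W. cscale (A q p) (create q (annih p f)))"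

lemma second_quant_fock: "f \<in> fock W \<Longrightarrow> second_quant W A f \<in> fock W"
  unfolding second_quant_def by (auto intro!: free_span_sum free_span_cscale create_fock annih_fock)

lemma second_quant_lin: "second_quant W A f = lin_ext (\<lambda>S. second_quant W A (Poly_Mapping.single S 1)) f"
proof -
  have "second_quant W A f = (\<Sum>z\<in>W \<times> W. lin_ext (\<lambda>S. cscale (A (fst z) (snd z)) (create (fst z) (annih (snd z) (Poly_Mapping.single S 1)))) f)"
    unfolding second_quant_def lin_ext_cscale_fun by (simp add: create_def annih_def lin_ext_compose case_prod_unfold)
  then show ?thesis
    by (simp add: second_quant_def case_prod_unfold lin_ext_sum_fun)
qed

lemma second_quant_linear:
  "second_quant W A (f + g) = second_quant W A f + second_quant W A g"
  "second_quant W A (cscale c f) = cscale c (second_quant W A f)"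
  "second_quant W A (f - g) = second_quant W A f - second_quant W A g"
  by (simp_all add: second_quant_def create_linear annih_linear pm.scale_right_distrib pm.scale_right_diff_distrib
      sum.distrib sum_subtractf pm.scale_sum_right mult.commute case_prod_unfold)

lemma second_quant_matrix_linear:
  "second_quant W (\<lambda>q p. A q p + B q p) f = second_quant W A f + second_quant W B f"
  "second_quant W (\<lambda>q p. c * A q p) f = cscale c (second_quant W A f)"
  "second_quant W (\<lambda>q p. A q p - B q p) f = second_quant W A f - second_quant W B f"
  by (simp_all add: second_quant_def pm.scale_left_distrib pm.scale_left_diff_distrib
      sum.distrib sum_subtractf pm.scale_sum_right case_prod_unfold)

lemma second_quant_cong:
  "(\<And>p q. p \<in> W \<Longrightarrow> q \<in> W \<Longrightarrow> A q p = B q p) \<Longrightarrow> second_quant W A f = second_quant W B f"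
  unfolding second_quant_def by (rule sum.cong) auto

lemma sum_over_product: "sum F (A \<times> B) = (\<Sum>q\<in>A. \<Sum>p\<in>B. F (q, p))"
  by (simp add: sum.cartesian_product)

text \<open>
  In \<open>\<psi>\<^sub>q \<psi>\<^sub>p\<^sup>* \<psi>\<^sub>t \<psi>\<^sub>s\<^sup>*\<close>, moving \<open>\<psi>\<^sub>p\<^sup>*\<close> past \<open>\<psi>\<^sub>t\<close> leaves the contraction \<open>\<delta>\<^sub>p\<^sub>t \<psi>\<^sub>q \<psi>\<^sub>s\<^sup>*\<close>, which makes up the
  matrix product, and a quartic term. The quartic term is symmetric in the two index pairs, so it
  drops out of the commutator.
\<close>

lemma second_quant_bracket:
  assumes "finite W" "f \<in> fock W"
  shows "second_quant W A (second_quant W B f) - second_quant W B (second_quant W A f) =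
    second_quant W (\<lambda>q s. (\<Sum>p\<in>W. A q p * B p s) - (\<Sum>p\<in>W. B q p * A p s)) f"
proof -
  \<comment> \<open>\<open>X\<close> is the quartic term, and \<open>R\<close> its total contribution to a product.\<close>
  define X where "X = (\<lambda>z z'. create (fst z) (create (fst z') (annih (snd z) (annih (snd z') f))))"
  have X_sym: "X z z' = X z' z" for z z'
  proof -
    have "X z z' = create (fst z) (create (fst z') (- annih (snd z') (annih (snd z) f)))"
      unfolding X_def by (subst annih_annih[OF assms]) simp
    also have "\<dots> = - create (fst z) (create (fst z') (annih (snd z') (annih (snd z) f)))"
      by (simp add: create_linear)
    also have "\<dots> = create (fst z') (create (fst z) (annih (snd z') (annih (snd z) f)))"
      by (subst create_create[OF assms(1)]) (auto intro!: annih_fock assms)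
    finally show ?thesis by (simp add: X_def)
  qed
  define R where "R = (\<lambda>A B. \<Sum>z\<in>W \<times> W. \<Sum>z'\<in>W \<times> W. cscale (A (fst z) (snd z) * B (fst z') (snd z')) (X z z'))"
  have R_sym: "R A B = R B A" for A B
  proof -
    have "R A B = (\<Sum>z'\<in>W \<times> W. \<Sum>z\<in>W \<times> W. cscale (A (fst z) (snd z) * B (fst z') (snd z')) (X z z'))"
      unfolding R_def by (rule sum.swap)
    also have "\<dots> = R B A"
      unfolding R_def by (intro sum.cong HOL.refl) (metis X_sym mult.commute)
    finally show ?thesis .
  qed
  have prod: "second_quant W A (second_quant W B f) = second_quant W (\<lambda>q s. \<Sum>p\<in>W. A q p * B p s) f - R A B" for A B
  proof -
    have "second_quant W A (second_quant W B f) =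
      (\<Sum>z\<in>W \<times> W. \<Sum>z'\<in>W \<times> W. cscale (A (fst z) (snd z) * B (fst z') (snd z'))
         (create (fst z) (annih (snd z) (create (fst z') (annih (snd z') f)))))"
      by (simp add: second_quant_def case_prod_unfold create_linear annih_linear pm.scale_sum_right)
    also have "\<dots> = (\<Sum>z\<in>W \<times> W. \<Sum>z'\<in>W \<times> W. (if snd z = fst z' then cscale (A (fst z) (snd z) * B (fst z') (snd z'))
         (create (fst z) (annih (snd z') f)) else 0) - cscale (A (fst z) (snd z) * B (fst z') (snd z')) (X z z'))"
      by (intro sum.cong HOL.refl)
        (auto simp: annih_create[OF assms(1) annih_fock[OF assms(2)]] X_def create_linear pm.scale_right_diff_distrib)
    also have "\<dots> = (\<Sum>z\<in>W \<times> W. \<Sum>z'\<in>W \<times> W. (if snd z = fst z' then cscale (A (fst z) (snd z) * B (fst z') (snd z'))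
         (create (fst z) (annih (snd z') f)) else 0)) - R A B"
      by (simp add: sum_subtractf R_def)
    also have "(\<Sum>z\<in>W \<times> W. \<Sum>z'\<in>W \<times> W. (if snd z = fst z' then cscale (A (fst z) (snd z) * B (fst z') (snd z'))
         (create (fst z) (annih (snd z') f)) else 0)) =
       (\<Sum>q\<in>W. \<Sum>p\<in>W. \<Sum>t\<in>W. \<Sum>s\<in>W. if p = t then cscale (A q p * B t s) (create q (annih s f)) else 0)"
      by (simp add: sum_over_product cong: if_cong)
    also have "\<dots> = (\<Sum>q\<in>W. \<Sum>p\<in>W. \<Sum>s\<in>W. \<Sum>t\<in>W. if p = t then cscale (A q p * B t s) (create q (annih s f)) else 0)"
      by (intro sum.cong HOL.refl sum.swap)
    also have "\<dots> = (\<Sum>q\<in>W. \<Sum>p\<in>W. \<Sum>s\<in>W. cscale (A q p * B p s) (create q (annih s f)))"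
      by (intro sum.cong HOL.refl) (use assms in \<open>simp add: sum.delta\<close>)
    also have "\<dots> = (\<Sum>q\<in>W. \<Sum>s\<in>W. \<Sum>p\<in>W. cscale (A q p * B p s) (create q (annih s f)))"
      by (intro sum.cong HOL.refl sum.swap)
    also have "\<dots> = second_quant W (\<lambda>q s. \<Sum>p\<in>W. A q p * B p s) f"
      by (simp add: second_quant_def pm.scale_sum_left sum_over_product)
    finally show ?thesis .
  qed
  show ?thesis
    unfolding prod second_quant_matrix_linear using R_sym[of A B] by simp
qed

section \<open>Matrix coefficients of \<open>\<G>\<^sub>r\<close>\<close>

lemma xy_act_ring:
  "xy_act (x + y) f = xy_act x f + xy_act y f"
  "xy_act (x * y) f = xy_act x (xy_act y f)"
  "xy_act (xy_const c) f = cscale c f"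
  "xy_act 0 f = 0"
  "xy_act 1 f = f"
  "xy_act (- x) f = - xy_act x f"
proof -
  show "xy_act (x + y) f = xy_act x f + xy_act y f" by transfer simp
  show "xy_act (x * y) f = xy_act x (xy_act y f)" by transfer simp
  show "xy_act (xy_const c) f = cscale c f" by transfer simp
  show "xy_act 0 f = 0" by transfer simp
  show "xy_act 1 f = f" by transfer simp
  show "xy_act (- x) f = - xy_act x f" by transfer simp
qed

lemma xy_act_generators:
  "xy_act xy_X (Poly_Mapping.single i c) = Poly_Mapping.single (i + 1) c"
  "xy_act xy_Y (Poly_Mapping.single i c) = Poly_Mapping.single i (of_int i * c)"
proof -
  show "xy_act xy_X (Poly_Mapping.single i c) = Poly_Mapping.single (i + 1) c"
    by transfer (rule poly_mapping_eqI, auto simp: lookup_X_times lookup_single when_def)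
  show "xy_act xy_Y (Poly_Mapping.single i c) = Poly_Mapping.single i (of_int i * c)"
    by transfer (rule poly_mapping_eqI, auto simp: lookup_X_times lookup_laurent_deriv lookup_single when_def)
qed

lemma xy_act_lin: "xy_act x f = lin_ext (\<lambda>k. xy_act x (Poly_Mapping.single k 1)) f"
proof -
  have add: "xy_act x (f + g) = xy_act x f + xy_act x g" for f g
    by transfer (rule xy_term_act_add)
  have scale: "xy_act x (cscale c f) = cscale c (xy_act x f)" for c f
    by transfer (rule xy_term_act_cscale)
  have zero: "xy_act x 0 = 0"
    using scale[of 0 0] by simp
  have sum: "xy_act x (sum g I) = (\<Sum>i\<in>I. xy_act x (g i))" for g and I :: "int set"
    by (induction I rule: infinite_finite_induct) (simp_all add: add zero)
  have "xy_act x f = xy_act x (lin_ext (\<lambda>S. Poly_Mapping.single S 1) f)"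
    by (simp only: lin_ext_basis_id)
  also have "\<dots> = lin_ext (\<lambda>k. xy_act x (Poly_Mapping.single k 1)) f"
    by (simp only: lin_ext_def sum scale)
  finally show ?thesis .
qed

text \<open>
  The generators act by \<open>x\<close> and \<open>xD\<close>, neither of which lowers the degree. Everything that follows
  about windows and truncation rests on this.
\<close>

lemma xy_act_raises:
  assumes "\<And>k. k < i \<Longrightarrow> Poly_Mapping.lookup f k = 0" "k < i"
  shows "Poly_Mapping.lookup (xy_act x f) k = 0"
  using assms
proof (transfer fixing: i k)
  fix t :: xy_term and f :: laurent
  assume "\<And>k. k < i \<Longrightarrow> Poly_Mapping.lookup f k = 0" "k < i"
  then show "Poly_Mapping.lookup (xy_term_act t f) k = 0"
  proof (induction t arbitrary: f k)
    case GenX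
    then show ?case by (simp add: lookup_X_times)
  next
    case GenY
    then show ?case by (simp add: lookup_X_times lookup_laurent_deriv)
  next
    case (Plus s t)
    then show ?case by (simp add: lookup_add)
  next
    case (Times s t)
    then show ?case by simp
  qed simp
qed

lemma mcoef_entry:
  "mcoef a q p = (if snd q < dim_row a
     then Poly_Mapping.lookup (xy_act (a $$ (snd q, snd p)) (Poly_Mapping.single (fst p) 1)) (fst q) else 0)"
proof -
  define h where "h = (\<lambda>j. xy_act (a $$ (j, snd p)) (Poly_Mapping.single (fst p) 1))"
  have "mcoef a q p = (\<Sum>j<dim_row a. \<Sum>m\<in>Poly_Mapping.keys (h j).
      if m = fst q \<and> j = snd q then Poly_Mapping.lookup (h j) m else 0)"
    unfolding mcoef_def vact_def Let_def lookup_sum h_def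
    by (intro sum.cong HOL.refl) (auto simp: lookup_single when_def)
  also have "\<dots> = (\<Sum>j<dim_row a. if j = snd q then Poly_Mapping.lookup (h j) (fst q) else 0)"
  proof (intro sum.cong HOL.refl)
    fix j
    show "(\<Sum>m\<in>Poly_Mapping.keys (h j). if m = fst q \<and> j = snd q then Poly_Mapping.lookup (h j) m else 0)
      = (if j = snd q then Poly_Mapping.lookup (h j) (fst q) else 0)"
      by (cases "j = snd q") (auto simp: in_keys_iff)
  qed
  also have "\<dots> = (if snd q < dim_row a then Poly_Mapping.lookup (h (snd q)) (fst q) else 0)"
    by simp
  finally show ?thesis by (simp add: h_def)
qed

lemma mcoef_nonzero:
  assumes "mcoef a q p \<noteq> 0"
  shows "fst p \<le> fst q" "snd q < dim_row a"
proof -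
  show "snd q < dim_row a" using assms by (auto simp: mcoef_entry split: if_splits)
  show "fst p \<le> fst q"
  proof (rule ccontr)
    assume "\<not> fst p \<le> fst q"
    then have "Poly_Mapping.lookup (xy_act (a $$ (snd q, snd p)) (Poly_Mapping.single (fst p) 1)) (fst q) = 0"
      by (intro xy_act_raises[where i = "fst p"]) (auto simp: lookup_single when_def)
    with assms show False by (simp add: mcoef_entry split: if_splits)
  qed
qed

lemma mcoef_linear:
  assumes "a \<in> gr_carrier r" "b \<in> gr_carrier r" "snd p < r"
  shows "mcoef (a + b) q p = mcoef a q p + mcoef b q p"
    and "mcoef (a - b) q p = mcoef a q p - mcoef b q p"
    and "mcoef (xy_const c \<cdot>\<^sub>m a) q p = c * mcoef a q p"
proof -
  have minus: "xy_act (x - y) f = xy_act x f - xy_act y f" for x y f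
    using xy_act_ring(1)[of x "- y" f] by (simp add: xy_act_ring)
  show "mcoef (a + b) q p = mcoef a q p + mcoef b q p"
    and "mcoef (a - b) q p = mcoef a q p - mcoef b q p"
    and "mcoef (xy_const c \<cdot>\<^sub>m a) q p = c * mcoef a q p"
    using assms by (auto simp: mcoef_entry xy_act_ring lookup_add lookup_minus minus)
qed

lemma mcoef_one: "snd p < r \<Longrightarrow> mcoef (1\<^sub>m r) q p = (if q = p then 1 else 0)"
  by (cases p; cases q) (auto simp: mcoef_entry xy_act_ring lookup_single when_def)

text \<open>
  Only degrees between \<open>i\<close> and \<open>m\<close> contribute to the matrix product, so any finite set containing
  them may serve as its range.
\<close>

lemma lookup_xy_act_mult:
  assumes "finite K" "{i..m} \<subseteq> K"
  shows "Poly_Mapping.lookup (xy_act (x * y) (Poly_Mapping.single i 1)) m =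
    (\<Sum>k\<in>K. Poly_Mapping.lookup (xy_act x (Poly_Mapping.single k 1)) m
      * Poly_Mapping.lookup (xy_act y (Poly_Mapping.single i 1)) k)"
proof -
  define g where "g = xy_act y (Poly_Mapping.single i 1)"
  have low: "Poly_Mapping.lookup g k = 0" if "k < i" for k
    unfolding g_def using that by (intro xy_act_raises[where i = i]) (auto simp: lookup_single when_def)
  have up: "Poly_Mapping.lookup (xy_act x (Poly_Mapping.single k 1)) m = 0" if "m < k" for k
    using that by (intro xy_act_raises[where i = k]) (auto simp: lookup_single when_def)
  have "Poly_Mapping.lookup (xy_act (x * y) (Poly_Mapping.single i 1)) m =
     (\<Sum>k\<in>Poly_Mapping.keys g \<union> K. Poly_Mapping.lookup g k * Poly_Mapping.lookup (xy_act x (Poly_Mapping.single k 1)) m)"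
    unfolding xy_act_ring g_def[symmetric] xy_act_lin[of x g]
    by (subst lin_ext_superset[of "Poly_Mapping.keys g \<union> K"]) (use assms in \<open>simp_all add: lookup_sum\<close>)
  also have "\<dots> = (\<Sum>k\<in>K. Poly_Mapping.lookup g k * Poly_Mapping.lookup (xy_act x (Poly_Mapping.single k 1)) m)"
  proof (rule sum.mono_neutral_right)
    show "\<forall>k\<in>Poly_Mapping.keys g \<union> K - K. Poly_Mapping.lookup g k * Poly_Mapping.lookup (xy_act x (Poly_Mapping.single k 1)) m = 0"
    proof
      fix k assume "k \<in> Poly_Mapping.keys g \<union> K - K"
      then have "k \<notin> {i..m}" using assms by auto
      then show "Poly_Mapping.lookup g k * Poly_Mapping.lookup (xy_act x (Poly_Mapping.single k 1)) m = 0"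
        using low[of k] up[of k] by auto
    qed
  qed (use assms in auto)
  finally show ?thesis by (simp add: g_def mult.commute)
qed

definition window :: "int \<Rightarrow> int \<Rightarrow> nat \<Rightarrow> idx set" where
  "window M N r = {M..<N} \<times> {..<r}"

lemma finite_window [simp]: "finite (window M N r)"
  by (simp add: window_def)

lemma lookup_xy_act_sum: "Poly_Mapping.lookup (xy_act (\<Sum>k\<in>I. x k) f) m = (\<Sum>k\<in>I. Poly_Mapping.lookup (xy_act (x k) f) m)"
  by (induction I rule: infinite_finite_induct) (simp_all add: xy_act_ring lookup_add)

text \<open>
  A path from \<open>p\<close> to \<open>q\<close> never leaves the degrees between those of \<open>p\<close> and \<open>q\<close>. Hence cutting the
  infinite matrices down to a window is multiplicative, and the commutator acquires no central term.
\<close>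

lemma mcoef_mult:
  assumes a: "a \<in> gr_carrier r" and b: "b \<in> gr_carrier r"
    and q: "q \<in> window M N r" and p: "p \<in> window M N r"
  shows "mcoef (a * b) q p = (\<Sum>s\<in>window M N r. mcoef a q s * mcoef b s p)"
proof -
  obtain m j where q': "q = (m, j)" by (cases q)
  obtain i l where p': "p = (i, l)" by (cases p)
  have b1: "m < N" "M \<le> i" "j < r" "l < r" using q p by (auto simp: window_def q' p')
  have "(a * b) $$ (j, l) = (\<Sum>k<r. a $$ (j, k) * b $$ (k, l))"
    using a b b1 by (simp add: scalar_prod_def lessThan_atLeast0)
  then have "mcoef (a * b) q p = (\<Sum>k<r. Poly_Mapping.lookup (xy_act (a $$ (j, k) * b $$ (k, l)) (Poly_Mapping.single i 1)) m)"
    using a b b1 by (simp add: mcoef_entry q' p' lookup_xy_act_sum)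
  also have "\<dots> = (\<Sum>k<r. \<Sum>t\<in>{M..<N}. Poly_Mapping.lookup (xy_act (a $$ (j, k)) (Poly_Mapping.single t 1)) m
      * Poly_Mapping.lookup (xy_act (b $$ (k, l)) (Poly_Mapping.single i 1)) t)"
    by (intro sum.cong HOL.refl lookup_xy_act_mult) (use b1 in auto)
  also have "\<dots> = (\<Sum>t\<in>{M..<N}. \<Sum>k<r. Poly_Mapping.lookup (xy_act (a $$ (j, k)) (Poly_Mapping.single t 1)) m
      * Poly_Mapping.lookup (xy_act (b $$ (k, l)) (Poly_Mapping.single i 1)) t)"
    by (rule sum.swap)
  also have "\<dots> = (\<Sum>t\<in>{M..<N}. \<Sum>k<r. mcoef a q (t, k) * mcoef b (t, k) p)"
    by (intro sum.cong HOL.refl) (use a b b1 in \<open>simp add: mcoef_entry q' p'\<close>)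
  finally show ?thesis by (simp add: window_def sum_over_product)
qed

lemma gr_bracket_closed: "a \<in> gr_carrier r \<Longrightarrow> b \<in> gr_carrier r \<Longrightarrow> gr_bracket a b \<in> gr_carrier r"
  by (simp add: gr_bracket_def minus_carrier_mat)

lemma second_quant_mcoef_bracket:
  assumes "a \<in> gr_carrier r" "b \<in> gr_carrier r" "f \<in> fock (window M N r)"
  shows "second_quant (window M N r) (mcoef (gr_bracket a b)) f =
    second_quant (window M N r) (mcoef a) (second_quant (window M N r) (mcoef b) f)
    - second_quant (window M N r) (mcoef b) (second_quant (window M N r) (mcoef a) f)"
proof -
  have "mcoef (gr_bracket a b) q p =
      (\<Sum>s\<in>window M N r. mcoef a q s * mcoef b s p) - (\<Sum>s\<in>window M N r. mcoef b q s * mcoef a s p)"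
    if "p \<in> window M N r" "q \<in> window M N r" for p q
  proof -
    have "snd p < r" using that by (auto simp: window_def)
    then show ?thesis
      unfolding gr_bracket_def
      using that assms mcoef_mult[OF assms(1,2) that(2,1)] mcoef_mult[OF assms(2,1) that(2,1)]
      by (subst mcoef_linear(2)[of _ r]) auto
  qed
  then show ?thesis
    by (subst second_quant_bracket[OF finite_window assms(3)]) (rule second_quant_cong)
qed

section \<open>The Leibniz action on wedges\<close>

lemma wedge_lin: "wedge f g = lin_ext (\<lambda>S. lin_ext (wedge_mono S) g) f"
  by (simp add: wedge_def lin_ext_def pm.scale_sum_right)

text \<open>
  This identity replaces the sign conventions of the wedge product by the anticommutation relations.
\<close>

lemma wedge_ugen: "wedge (ugen p) g = create p g"
proof -
  have "wedge_mono {p} S = (if p \<in> S then 0 else Poly_Mapping.single (insert p S) (inv_sign p S))" for S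
  proof -
    have "{(s, t). s \<in> {p} \<and> t \<in> S \<and> t < s} = Pair p ` {t\<in>S. t < p}" by auto
    then have "card {(s, t). s \<in> {p} \<and> t \<in> S \<and> t < s} = card {t\<in>S. t < p}"
      by (simp add: card_image inj_on_def)
    then show ?thesis by (simp add: wedge_mono_def inv_sign_def)
  qed
  then show ?thesis by (simp add: wedge_lin ugen_def create_def cong: lin_ext_cong)
qed

lemma wedge_combination: "wedge (\<Sum>q\<in>W. cscale (c q) (ugen q)) g = (\<Sum>q\<in>W. cscale (c q) (create q g))"
  by (simp add: wedge_ugen[symmetric] wedge_lin lin_ext_sum lin_ext_cscale)

lemma wedge_list_ugen: "wedge_list (map ugen ps) = foldr create ps (Poly_Mapping.single {} 1)"
  by (induction ps) (simp_all add: wedge_list_def wedge_ugen)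

lemma foldr_create_sorted:
  "sorted_wrt (<) ps \<Longrightarrow> foldr create ps (Poly_Mapping.single {} 1) = Poly_Mapping.single (set ps) 1"
proof (induction ps)
  case (Cons p ps)
  then have "inv_sign p (set ps) = 1"
    by (simp add: inv_sign_def) (metis (no_types, lifting) Collect_empty_eq card.empty less_asym power_0)
  moreover have "p \<notin> set ps" using Cons.prems by auto
  ultimately show ?case using Cons by (simp add: create_single)
qed simp

lemma wedge_list_sorted:
  "sorted_wrt (<) ps \<Longrightarrow> wedge_list (map ugen ps) = Poly_Mapping.single (set ps) 1"
  by (simp add: wedge_list_ugen foldr_create_sorted)

lemma foldr_create_fock: "set ps \<subseteq> W \<Longrightarrow> foldr create ps (Poly_Mapping.single {} 1) \<in> fock W"
  by (induction ps) (auto simp: free_span_single intro: create_fock)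

text \<open>
  The commutator of \<open>second_quant W A\<close> with \<open>\<psi>\<^sub>p\<close> creates the column \<open>p\<close> of \<open>A\<close>: one step of the Leibniz rule.
\<close>

lemma second_quant_create:
  assumes "finite W" "f \<in> fock W" "p \<in> W"
  shows "second_quant W A (create p f) = create p (second_quant W A f) + (\<Sum>q\<in>W. cscale (A q p) (create q f))"
proof -
  have "second_quant W A (create p f) = (\<Sum>q\<in>W. \<Sum>t\<in>W. cscale (A q t) (create q (annih t (create p f))))"
    by (simp add: second_quant_def sum_over_product)
  also have "\<dots> = (\<Sum>q\<in>W. \<Sum>t\<in>W. cscale (A q t) (create p (create q (annih t f)))
      + (if t = p then cscale (A q t) (create q f) else 0))"
  proof (intro sum.cong HOL.refl)
    fix q t
    show "cscale (A q t) (create q (annih t (create p f))) = cscale (A q t) (create p (create q (annih t f)))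
      + (if t = p then cscale (A q t) (create q f) else 0)"
      unfolding annih_create[OF assms(1,2)] create_linear
        create_create[OF assms(1) annih_fock[OF assms(2)], of q p]
      by (simp add: pm.scale_right_distrib create_linear)
  qed
  also have "\<dots> = create p (second_quant W A f) + (\<Sum>q\<in>W. cscale (A q p) (create q f))"
    using assms by (simp add: sum.distrib second_quant_def sum_over_product create_linear)
  finally show ?thesis .
qed

lemma second_quant_foldr_create:
  assumes "finite W" "set ps \<subseteq> W"
  shows "second_quant W A (foldr create ps (Poly_Mapping.single {} 1)) =
    (\<Sum>k<length ps. wedge_list ((map ugen ps)[k := \<Sum>q\<in>W. cscale (A q (ps ! k)) (ugen q)]))"
  using assms(2)
proof (induction ps)
  case Nil
  show ?case by (simp add: second_quant_def annih_single create_linear)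
next
  case (Cons p ps)
  let ?v = "foldr create ps (Poly_Mapping.single {} 1)"
  have "second_quant W A (create p ?v) = create p (second_quant W A ?v) + (\<Sum>q\<in>W. cscale (A q p) (create q ?v))"
    by (rule second_quant_create) (use Cons.prems assms(1) in \<open>auto intro: foldr_create_fock\<close>)
  moreover have "(\<Sum>q\<in>W. cscale (A q p) (create q ?v)) = wedge_list ((\<Sum>q\<in>W. cscale (A q p) (ugen q)) # map ugen ps)"
    by (simp add: wedge_list_def wedge_combination flip: wedge_list_ugen)
  moreover have "create p (second_quant W A ?v) =
      (\<Sum>k<length ps. wedge_list (ugen p # (map ugen ps)[k := \<Sum>q\<in>W. cscale (A q (ps ! k)) (ugen q)]))"
    using Cons by (simp add: create_linear wedge_list_def wedge_ugen)
  ultimately show ?case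
    by (simp add: lessThan_Suc_eq_insert_0 sum.reindex)
qed

text \<open>
  The upper end of the window truncates as the quotient by \<open>x\<^sup>N\<close> does; its lower end loses nothing,
  as the degree of \<open>p\<close> is in the window and is not lowered.
\<close>

lemma vact_trunc_window:
  assumes "p \<in> window M N r" "a \<in> gr_carrier r"
  shows "vact_trunc N a p = (\<Sum>q\<in>window M N r. cscale (mcoef a q p) (ugen q))"
  unfolding vact_trunc_def
proof (rule sum.mono_neutral_left)
  show "{q \<in> Poly_Mapping.keys (vact a p). fst q < N} \<subseteq> window M N r"
  proof
    fix q assume "q \<in> {q \<in> Poly_Mapping.keys (vact a p). fst q < N}"
    then have "mcoef a q p \<noteq> 0" "fst q < N" by (auto simp: mcoef_def in_keys_iff)
    then show "q \<in> window M N r"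
      using mcoef_nonzero[of a q p] assms by (cases q) (auto simp: window_def)
  qed
qed (auto simp: mcoef_def in_keys_iff window_def)

text \<open>
  A monomial is created from the vacuum by its factors in increasing order, and a derivation kills the
  vacuum, so the Leibniz rule applies to this product.
\<close>

lemma ext_act_mono_second_quant:
  assumes "S \<subseteq> window M N r" "a \<in> gr_carrier r"
  shows "ext_act_mono N a S = second_quant (window M N r) (mcoef a) (Poly_Mapping.single S 1)"
proof -
  have fin: "finite S" using assms(1) by (rule finite_subset) simp
  let ?ps = "sorted_list_of_set S"
  have "second_quant (window M N r) (mcoef a) (Poly_Mapping.single S 1)
     = second_quant (window M N r) (mcoef a) (foldr create ?ps (Poly_Mapping.single {} 1))"
    using fin by (simp add: foldr_create_sorted)
  also have "\<dots> = ext_act_mono N a S"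
    unfolding ext_act_mono_def Let_def
  proof (subst second_quant_foldr_create)
    show "(\<Sum>k<length ?ps. wedge_list ((map ugen ?ps)[k := \<Sum>q\<in>window M N r. cscale (mcoef a q (?ps ! k)) (ugen q)])) =
      (\<Sum>k<length ?ps. wedge_list ((map ugen ?ps)[k := vact_trunc N a (?ps ! k)]))"
    proof (intro sum.cong HOL.refl)
      fix k assume "k \<in> {..<length ?ps}"
      then have "?ps ! k \<in> set ?ps" by (simp del: set_sorted_list_of_set)
      then have "?ps ! k \<in> window M N r" using fin assms(1) by auto
      then show "wedge_list ((map ugen ?ps)[k := \<Sum>q\<in>window M N r. cscale (mcoef a q (?ps ! k)) (ugen q)]) =
          wedge_list ((map ugen ?ps)[k := vact_trunc N a (?ps ! k)])"
        using assms(2) by (simp add: vact_trunc_window)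
    qed
  qed (use fin assms in auto)
  finally show ?thesis by simp
qed

lemma ext_act_lin: "ext_act N a = lin_ext (ext_act_mono N a)"
  by (simp add: ext_act_def lin_ext_def fun_eq_iff)

lemma ext_act_second_quant:
  assumes "f \<in> fock (window M N r)" "a \<in> gr_carrier r"
  shows "ext_act N a f = second_quant (window M N r) (mcoef a) f"
  unfolding ext_act_lin second_quant_lin[of _ _ f]
  by (rule lin_ext_cong) (use assms ext_act_mono_second_quant in \<open>auto simp: free_span_def\<close>)

lemma create_annih_same:
  "finite S \<Longrightarrow> create p (annih p (Poly_Mapping.single S c)) = (if p \<in> S then Poly_Mapping.single S c else 0)"
  by (auto simp: annih_single create_single create_linear inv_sign_remove insert_absorb mult.assoc)

lemma lookup_second_quant_trace:
  assumes "finite W" "S \<subseteq> W"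
  shows "Poly_Mapping.lookup (second_quant W A (Poly_Mapping.single S 1)) S = (\<Sum>p\<in>S. A p p)"
proof -
  have *: "Poly_Mapping.lookup (create q (annih p (Poly_Mapping.single S 1))) S = (if q = p \<and> p \<in> S then 1 else 0)" for q p
  proof (cases "q = p")
    case True
    then show ?thesis using finite_subset[OF assms(2,1)] by (simp add: create_annih_same)
  next
    case False
    have "insert q (S - {p}) \<noteq> S" if "p \<in> S" using that False by auto
    then show ?thesis using False
      by (auto simp: annih_single create_single create_linear lookup_single when_def)
  qed
  have "Poly_Mapping.lookup (second_quant W A (Poly_Mapping.single S 1)) S = (\<Sum>p\<in>W. \<Sum>q\<in>W. if q = p then (if p \<in> S then A q p else 0) else 0)"
    unfolding second_quant_def sum_over_product lookup_sum
    by (subst sum.swap, simp add: lookup_sum *, intro sum.cong HOL.refl) auto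
  also have "\<dots> = (\<Sum>p\<in>W. if p \<in> S then A p p else 0)"
    using assms by simp
  also have "\<dots> = (\<Sum>p\<in>S. A p p)"
    using assms by (simp add: sum.inter_restrict[symmetric] Int_absorb1)
  finally show ?thesis .
qed

lemma top_char_sum:
  assumes "a \<in> gr_carrier r"
  shows "top_char r N a = (\<Sum>p\<in>top_set r N. mcoef a p p)"
proof -
  have w: "top_set r N = window 0 (int N) r" by (simp add: top_set_def window_def)
  show ?thesis
    unfolding top_char_def w
    by (subst ext_act_second_quant[where M = 0 and r = r])
      (use assms in \<open>auto intro: free_span_single simp: lookup_second_quant_trace\<close>)
qed

text \<open>
  The character vanishes on brackets because it is the trace over a window, on which the matrices
  multiply exactly.
\<close>

lemma top_char_linear:
  assumes "a \<in> gr_carrier r" "b \<in> gr_carrier r"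
  shows "top_char r N (a + b) = top_char r N a + top_char r N b"
    and "top_char r N (xy_const c \<cdot>\<^sub>m a) = c * top_char r N a"
    and "top_char r N (gr_bracket a b) = 0"
proof -
  have snd: "snd p < r" if "p \<in> top_set r N" for p using that by (auto simp: top_set_def)
  show "top_char r N (a + b) = top_char r N a + top_char r N b"
    using assms snd by (simp add: top_char_sum mcoef_linear sum.distrib)
  show "top_char r N (xy_const c \<cdot>\<^sub>m a) = c * top_char r N a"
    using assms snd by (simp add: top_char_sum mcoef_linear sum_distrib_left)
  have w: "top_set r N = window 0 (int N) r" by (simp add: top_set_def window_def)
  have "top_char r N (gr_bracket a b) = (\<Sum>p\<in>top_set r N. mcoef (a * b) p p - mcoef (b * a) p p)"
    using assms snd by (simp add: top_char_sum gr_bracket_closed) (simp add: gr_bracket_def mcoef_linear(2)[of _ r])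
  also have "\<dots> = (\<Sum>p\<in>top_set r N. \<Sum>s\<in>top_set r N. mcoef a p s * mcoef b s p)
     - (\<Sum>p\<in>top_set r N. \<Sum>s\<in>top_set r N. mcoef b p s * mcoef a s p)"
    unfolding w using assms by (simp add: sum_subtractf mcoef_mult)
  also have "(\<Sum>p\<in>top_set r N. \<Sum>s\<in>top_set r N. mcoef b p s * mcoef a s p)
     = (\<Sum>p\<in>top_set r N. \<Sum>s\<in>top_set r N. mcoef a p s * mcoef b s p)"
    by (subst sum.swap) (simp add: mult.commute)
  finally show "top_char r N (gr_bracket a b) = 0" by simp
qed

section \<open>Filling the sea\<close>

definition sea :: "nat \<Rightarrow> nat \<Rightarrow> idx set" where
  "sea r N = {int N..} \<times> {..<r}"

definition below :: "nat \<Rightarrow> nat \<Rightarrow> idx set" where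
  "below r N = {..<int N} \<times> {..<r}"

definition stage_space :: "nat \<Rightarrow> nat \<Rightarrow> nat \<Rightarrow> ext set" where
  "stage_space r N m = free_span {S. finite S \<and> S \<subseteq> below r N \<and> card S = m}"

text \<open>
  The sea is the set of the places of degree at least \<open>N\<close>. All factors of a monomial of stage \<open>N\<close> precede
  it in the lexicographic order, so appending it costs no sign.
\<close>

definition fill_sea :: "nat \<Rightarrow> nat \<Rightarrow> ext \<Rightarrow> semi" where
  "fill_sea r N = lin_ext (\<lambda>S. Poly_Mapping.single (S \<union> sea r N) 1)"

text \<open>
  The action on the exterior power twisted by \<open>\<delta>\<^sub>N\<close>, as in the modules of the system.
\<close>

definition stage_act :: "nat \<Rightarrow> nat \<Rightarrow> gr \<Rightarrow> ext \<Rightarrow> ext" where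
  "stage_act r N a u = ext_act (int N) a u + cscale (- top_char r N a) u"

lemma window_subset_below: "window M (int N) r \<subseteq> below r N"
  by (auto simp: window_def below_def)

lemma finite_below_window:
  assumes "finite B" "B \<subseteq> below r N"
  obtains M where "M \<le> 0" "B \<subseteq> window M (int N) r"
proof
  let ?M = "Min (insert 0 (fst ` B))"
  show "?M \<le> 0" using assms by simp
  show "B \<subseteq> window ?M (int N) r"
  proof
    fix p assume "p \<in> B"
    then have "?M \<le> fst p" using assms by simp
    then show "p \<in> window ?M (int N) r"
      using \<open>p \<in> B\<close> assms(2) by (cases p) (auto simp: window_def below_def)
  qed
qed

lemma stage_space_window:
  assumes "f \<in> stage_space r N m"
  obtains M where "M \<le> 0" "f \<in> fock (window M (int N) r)"
proof -
  have fin: "finite (\<Union>(Poly_Mapping.keys f))"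
    using assms by (auto simp: stage_space_def free_span_def)
  have sub: "\<Union>(Poly_Mapping.keys f) \<subseteq> below r N"
    using assms by (auto simp: stage_space_def free_span_def)
  obtain M where "M \<le> 0" "\<Union>(Poly_Mapping.keys f) \<subseteq> window M (int N) r"
    by (rule finite_below_window[OF fin sub])
  then show ?thesis by (intro that[of M]) (auto simp: free_span_def)
qed

lemma stage_space_below: "stage_space r N m \<subseteq> fock (below r N)"
  unfolding stage_space_def by (rule free_span_mono) auto

lemma fock_window_below: "fock (window M (int N) r) \<subseteq> fock (below r N)"
  by (rule free_span_mono) (use window_subset_below in blast)

lemma fill_sea_linear:
  "fill_sea r N 0 = 0"
  "fill_sea r N (f + g) = fill_sea r N f + fill_sea r N g"
  "fill_sea r N (f - g) = fill_sea r N f - fill_sea r N g"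
  "fill_sea r N (cscale c f) = cscale c (fill_sea r N f)"
  "fill_sea r N (sum h I) = (\<Sum>i\<in>I. fill_sea r N (h i))"
  by (simp_all add: fill_sea_def lin_ext_add lin_ext_diff lin_ext_cscale lin_ext_sum)

lemma fill_sea_single: "fill_sea r N (Poly_Mapping.single S c) = Poly_Mapping.single (S \<union> sea r N) c"
  by (simp add: fill_sea_def)

lemma below_sea_disjoint: "below r N \<inter> sea r N = {}"
  by (auto simp: below_def sea_def)

lemma union_sea_inj: "S \<subseteq> below r N \<Longrightarrow> T \<subseteq> below r N \<Longrightarrow> S \<union> sea r N = T \<union> sea r N \<Longrightarrow> S = T"
  using below_sea_disjoint[of r N] by blast

lemma lookup_fill_sea:
  assumes "f \<in> fock (below r N)" "S \<subseteq> below r N"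
  shows "Poly_Mapping.lookup (fill_sea r N f) (S \<union> sea r N) = Poly_Mapping.lookup f S"
proof -
  have "Poly_Mapping.lookup (fill_sea r N f) (S \<union> sea r N) =
      (\<Sum>T\<in>Poly_Mapping.keys f. if T = S then Poly_Mapping.lookup f T else 0)"
    unfolding fill_sea_def lin_ext_def lookup_sum
  proof (intro sum.cong HOL.refl)
    fix T assume "T \<in> Poly_Mapping.keys f"
    then have "T \<subseteq> below r N" using assms(1) by (auto simp: free_span_def)
    then have "T \<union> sea r N = S \<union> sea r N \<longleftrightarrow> T = S"
      using union_sea_inj assms(2) by blast
    then show "Poly_Mapping.lookup (cscale (Poly_Mapping.lookup f T) (Poly_Mapping.single (T \<union> sea r N) 1)) (S \<union> sea r N)
        = (if T = S then Poly_Mapping.lookup f T else 0)"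
      by (simp add: lookup_single when_def)
  qed
  also have "\<dots> = Poly_Mapping.lookup f S" by (simp add: in_keys_iff)
  finally show ?thesis .
qed

lemma inj_on_fill_sea: "inj_on (fill_sea r N) (fock (below r N))"
proof (rule inj_onI)
  fix f g assume fg: "f \<in> fock (below r N)" "g \<in> fock (below r N)" and eq: "fill_sea r N f = fill_sea r N g"
  show "f = g"
  proof (rule poly_mapping_eqI)
    fix S
    show "Poly_Mapping.lookup f S = Poly_Mapping.lookup g S"
    proof (cases "S \<subseteq> below r N")
      case True
      then show ?thesis using lookup_fill_sea fg eq by metis
    next
      case False
      then have "S \<notin> Poly_Mapping.keys f" "S \<notin> Poly_Mapping.keys g" using fg by (auto simp: free_span_def)
      then show ?thesis by (simp add: in_keys_iff)
    qed
  qed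
qed

text \<open>
  Annihilating \<open>p\<close> and then creating \<open>q\<close> counts the factors below \<open>p\<close> and those below \<open>q\<close>; in the product
  of the two signs only the factors strictly between them survive, which is the sign rule of
  \<open>semi_replace\<close>.
\<close>

lemma create_annih_replace:
  assumes "finite S" "q \<noteq> p"
  shows "create q (annih p (Poly_Mapping.single S 1)) =
    (if p \<in> S \<and> q \<notin> S then Poly_Mapping.single (insert q (S - {p})) ((-1) ^ card {h\<in>S. min p q < h \<and> h < max p q}) else 0)"
proof (cases "p \<in> S \<and> q \<notin> S")
  case True
  let ?B = "{h\<in>S. min p q < h \<and> h < max p q}"
  have "inv_sign p S * inv_sign q (S - {p}) = (-1) ^ card ?B"
  proof (cases "p < q")
    case pq: True
    let ?A = "{s\<in>S. s < p}"
    have "{s \<in> S - {p}. s < q} = ?A \<union> ?B" "?A \<inter> ?B = {}"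
      using pq True by (auto simp: min_def max_def)
    then have "card {s \<in> S - {p}. s < q} = card ?A + card ?B"
      using assms by (simp add: card_Un_disjoint)
    then show ?thesis by (simp add: inv_sign_def power_add flip: mult.assoc power_mult_distrib)
  next
    case False
    then have qp: "q < p" using assms by simp
    let ?A = "{s\<in>S - {p}. s < q}"
    have "{s \<in> S. s < p} = ?A \<union> ?B" "?A \<inter> ?B = {}"
      using qp True by (auto simp: min_def max_def not_less order_le_less)
    then have "card {s \<in> S. s < p} = card ?A + card ?B"
      using assms by (simp add: card_Un_disjoint)
    then have "inv_sign p S * inv_sign q (S - {p}) = (-1) ^ card ?B * ((-1) ^ card ?A * (-1) ^ card ?A)"
      by (simp add: inv_sign_def power_add mult_ac)
    then show ?thesis by (simp flip: power_mult_distrib)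
  qed
  then show ?thesis using True assms by (simp add: annih_single create_single)
next
  case False
  then show ?thesis using assms by (auto simp: annih_single create_single create_linear)
qed

text \<open>
  Occupied places of degree \<open>0 \<le> i < N\<close> do not count on the left, and on the right they cancel against
  the trace over all places of these degrees; the empty ones are subtracted on both sides.
\<close>

lemma semi_diag_eq:
  assumes "finite S" "S \<subseteq> below r N" "a \<in> gr_carrier r"
  shows "semi_diag r a (S \<union> sea r N) = (\<Sum>p\<in>S. mcoef a p p) - top_char r N a"
proof -
  let ?c = "\<lambda>p. mcoef a p p"
  have top: "finite (top_set r N)" by (simp add: top_set_def)
  have 1: "{p \<in> S \<union> sea r N. fst p < 0} = S - top_set r N"
    using assms(2) by (auto simp: below_def sea_def top_set_def)
  have 2: "({0..} \<times> {..<r}) - (S \<union> sea r N) = top_set r N - S"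
    by (auto simp: sea_def top_set_def)
  have "sum ?c S = sum ?c (S - top_set r N) + sum ?c (S \<inter> top_set r N)"
    using sum.Int_Diff[OF assms(1), of ?c "top_set r N"] by (simp add: add.commute)
  moreover have "sum ?c (top_set r N) = sum ?c (top_set r N - S) + sum ?c (S \<inter> top_set r N)"
    using sum.Int_Diff[OF top, of ?c S] by (simp add: add.commute Int_commute)
  ultimately show ?thesis
    unfolding semi_diag_def 1 2 top_char_sum[OF assms(3)] by simp
qed

text \<open>
  The off-diagonal transitions of the semi-infinite monomial are those from \<open>S\<close> to free places of the
  window. A place \<open>q\<close> outside \<open>S\<close> and the sea has degree below \<open>N\<close>, so it is reached from degrees
  below \<open>N\<close> only, that is, from \<open>S\<close>.
\<close>

lemma semi_act_mono_fill_sea: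
  assumes S: "S \<subseteq> window M (int N) r" and a: "a \<in> gr_carrier r"
  shows "semi_act_mono r a (S \<union> sea r N) = fill_sea r N (stage_act r N a (Poly_Mapping.single S 1))"
proof -
  let ?W = "window M (int N) r" and ?H = "S \<union> sea r N"
  let ?u = "Poly_Mapping.single S (1::complex)"
  define P where "P = {(p, q). p \<in> ?H \<and> q \<noteq> p \<and> q \<notin> ?H \<and> mcoef a q p \<noteq> 0}"
  have fin: "finite S" using S by (rule finite_subset) simp
  have Sb: "S \<subseteq> below r N" using S window_subset_below by blast
  have P_window: "P \<subseteq> S \<times> (?W - S)"
  proof
    fix z assume "z \<in> P"
    then obtain p q where z: "z = (p, q)" and pq: "p \<in> ?H" "q \<notin> ?H" "mcoef a q p \<noteq> 0"
      by (auto simp: P_def)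
    have le: "fst p \<le> fst q" and j: "snd q < r" using mcoef_nonzero[OF pq(3)] a by auto
    have qN: "fst q < int N" using pq(2) j by (cases q) (auto simp: sea_def)
    then have "p \<in> S" using pq(1) le by (auto simp: sea_def)
    then have "M \<le> fst p" using S by (auto simp: window_def)
    then have "q \<in> ?W" using le j qN by (cases q) (auto simp: window_def)
    then show "z \<in> S \<times> (?W - S)" using \<open>p \<in> S\<close> pq z by auto
  qed
  have off: "(\<Sum>(p, q)\<in>P. cscale (mcoef a q p) (semi_replace ?H p q)) =
     (\<Sum>(p, q)\<in>S \<times> (?W - S). cscale (mcoef a q p) (fill_sea r N (create q (annih p ?u))))"
  proof (rule sum.mono_neutral_cong_left)
    show "finite (S \<times> (?W - S))" using fin by simp
    show "\<forall>z\<in>S \<times> (?W - S) - P. (case z of (p, q) \<Rightarrow> cscale (mcoef a q p) (fill_sea r N (create q (annih p ?u)))) = 0"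
      using S by (auto simp: P_def sea_def window_def)
    fix z assume z: "z \<in> P"
    obtain p q where zz: "z = (p, q)" by (cases z)
    have pq: "p \<in> S" "q \<in> ?W" "q \<notin> S" "q \<notin> ?H" "q \<noteq> p"
      using z P_window by (auto simp: P_def zz)
    have "fst (max p q) < int N" using pq S by (auto simp: window_def max_def)
    then have between: "{h \<in> ?H. min p q < h \<and> h < max p q} = {h \<in> S. min p q < h \<and> h < max p q}"
      by (auto simp: sea_def less_prod_def)
    have "p \<notin> sea r N" using pq Sb below_sea_disjoint by blast
    then have set: "insert q (?H - {p}) = insert q (S - {p}) \<union> sea r N" by auto
    have "semi_replace ?H p q = fill_sea r N (create q (annih p ?u))"
      unfolding semi_replace_def between set
      using pq fin by (simp add: create_annih_replace fill_sea_single)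
    then show "(case z of (p, q) \<Rightarrow> cscale (mcoef a q p) (semi_replace ?H p q)) =
       (case z of (p, q) \<Rightarrow> cscale (mcoef a q p) (fill_sea r N (create q (annih p ?u))))"
      by (simp add: zz)
  qed (rule P_window)
  have "ext_act (int N) a ?u = second_quant ?W (mcoef a) ?u"
    using ext_act_second_quant[OF free_span_single a] S by simp
  also have "\<dots> = (\<Sum>p\<in>?W. \<Sum>q\<in>?W. cscale (mcoef a q p) (create q (annih p ?u)))"
    unfolding second_quant_def sum_over_product prod.case by (rule sum.swap)
  also have "\<dots> = (\<Sum>p\<in>S. \<Sum>q\<in>?W. cscale (mcoef a q p) (create q (annih p ?u)))"
    by (rule sum.mono_neutral_right) (use S in \<open>auto simp: annih_single create_linear\<close>)
  also have "\<dots> = (\<Sum>p\<in>S. cscale (mcoef a p p) ?u + (\<Sum>q\<in>?W - S. cscale (mcoef a q p) (create q (annih p ?u))))"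
  proof (intro sum.cong HOL.refl)
    fix p assume p: "p \<in> S"
    have "(\<Sum>q\<in>?W. cscale (mcoef a q p) (create q (annih p ?u))) =
       (\<Sum>q\<in>insert p (?W - S). cscale (mcoef a q p) (create q (annih p ?u)))"
      by (rule sum.mono_neutral_right)
        (use p S fin in \<open>auto simp: create_annih_replace\<close>)
    also have "\<dots> = cscale (mcoef a p p) ?u + (\<Sum>q\<in>?W - S. cscale (mcoef a q p) (create q (annih p ?u)))"
      using p fin by (simp add: create_annih_same)
    finally show "(\<Sum>q\<in>?W. cscale (mcoef a q p) (create q (annih p ?u))) =
      cscale (mcoef a p p) ?u + (\<Sum>q\<in>?W - S. cscale (mcoef a q p) (create q (annih p ?u)))" .
  qed
  also have "\<dots> = cscale (\<Sum>p\<in>S. mcoef a p p) ?u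
      + (\<Sum>(p, q)\<in>S \<times> (?W - S). cscale (mcoef a q p) (create q (annih p ?u)))"
    by (simp add: sum.distrib sum_over_product pm.scale_sum_left del: cscale_single)
  finally have ext: "ext_act (int N) a ?u = \<dots>" .
  have "semi_act_mono r a ?H = (\<Sum>(p, q)\<in>P. cscale (mcoef a q p) (semi_replace ?H p q))
     + cscale ((\<Sum>p\<in>S. mcoef a p p) - top_char r N a) (Poly_Mapping.single ?H 1)"
    unfolding semi_act_mono_def P_def semi_diag_eq[OF fin Sb a] by (simp add: sea_def)
  also have "\<dots> = fill_sea r N (stage_act r N a ?u)"
    unfolding off stage_act_def ext
    by (simp add: fill_sea_linear fill_sea_single case_prod_unfold single_diff[symmetric] single_neg add.commute del: cscale_single)
       (simp add: single_diff)
  finally show ?thesis .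
qed

lemma stage_act_lin: "stage_act r N a = lin_ext (\<lambda>S. stage_act r N a (Poly_Mapping.single S 1))"
proof
  fix f :: ext
  have "lin_ext (\<lambda>S. cscale (- top_char r N a) (Poly_Mapping.single S 1)) f = cscale (- top_char r N a) f"
    by (simp only: lin_ext_cscale_fun lin_ext_basis_id)
  then show "stage_act r N a f = lin_ext (\<lambda>S. stage_act r N a (Poly_Mapping.single S 1)) f"
    unfolding stage_act_def by (simp add: lin_ext_plus_fun ext_act_lin)
qed

lemma semi_act_lin: "semi_act r a = lin_ext (semi_act_mono r a)"
  by (simp add: semi_act_def lin_ext_def fun_eq_iff)

lemma semi_act_fill_sea:
  assumes "f \<in> fock (window M (int N) r)" "a \<in> gr_carrier r"
  shows "semi_act r a (fill_sea r N f) = fill_sea r N (stage_act r N a f)"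
proof -
  have "semi_act r a (fill_sea r N f) = lin_ext (\<lambda>S. semi_act_mono r a (S \<union> sea r N)) f"
    by (simp add: semi_act_lin fill_sea_def lin_ext_compose)
  also have "\<dots> = lin_ext (\<lambda>S. fill_sea r N (stage_act r N a (Poly_Mapping.single S 1))) f"
    by (rule lin_ext_cong) (use assms semi_act_mono_fill_sea in \<open>auto simp: free_span_def\<close>)
  also have "\<dots> = fill_sea r N (stage_act r N a f)"
    by (subst (2) stage_act_lin) (simp add: fill_sea_def lin_ext_compose)
  finally show ?thesis .
qed

lemma stage_act_linear:
  "stage_act r N a (f + g) = stage_act r N a f + stage_act r N a g"
  "stage_act r N a (cscale c f) = cscale c (stage_act r N a f)"
  by (subst (1 2 3) stage_act_lin, simp add: lin_ext_add) (subst (1 2) stage_act_lin, simp add: lin_ext_cscale)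

lemma stage_act_fock:
  assumes "f \<in> fock (window M (int N) r)" "a \<in> gr_carrier r"
  shows "stage_act r N a f \<in> fock (window M (int N) r)"
  unfolding stage_act_def using assms
  by (auto simp: ext_act_second_quant intro!: free_span_diff free_span_cscale second_quant_fock)

lemma stage_act_gr:
  assumes f: "f \<in> fock (window M (int N) r)" and a: "a \<in> gr_carrier r" and b: "b \<in> gr_carrier r"
  shows "stage_act r N (a + b) f = stage_act r N a f + stage_act r N b f"
    and "stage_act r N (xy_const c \<cdot>\<^sub>m a) f = cscale c (stage_act r N a f)"
    and "stage_act r N (gr_bracket a b) f = stage_act r N a (stage_act r N b f) - stage_act r N b (stage_act r N a f)"
proof -
  let ?W = "window M (int N) r"
  have snd: "snd p < r" if "p \<in> ?W" for p using that by (auto simp: window_def)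
  have eq: "stage_act r N a g = second_quant ?W (mcoef a) g + cscale (- top_char r N a) g"
    if "g \<in> fock ?W" "a \<in> gr_carrier r" for a g
    using that by (simp add: stage_act_def ext_act_second_quant)
  have "second_quant ?W (mcoef (a + b)) f = second_quant ?W (mcoef a) f + second_quant ?W (mcoef b) f"
    unfolding second_quant_matrix_linear(1)[symmetric] by (rule second_quant_cong) (use a b snd mcoef_linear in auto)
  then show "stage_act r N (a + b) f = stage_act r N a f + stage_act r N b f"
    using a b f by (simp add: eq top_char_linear(1) pm.scale_left_diff_distrib)
  have "second_quant ?W (mcoef (xy_const c \<cdot>\<^sub>m a)) f = cscale c (second_quant ?W (mcoef a) f)"
    unfolding second_quant_matrix_linear(2)[symmetric] by (rule second_quant_cong) (use a snd mcoef_linear in auto)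
  then show "stage_act r N (xy_const c \<cdot>\<^sub>m a) f = cscale c (stage_act r N a f)"
    using a f by (simp add: eq top_char_linear(2)[OF a a] pm.scale_right_diff_distrib)
  have "stage_act r N a (stage_act r N b f) - stage_act r N b (stage_act r N a f) =
    second_quant ?W (mcoef a) (second_quant ?W (mcoef b) f) - second_quant ?W (mcoef b) (second_quant ?W (mcoef a) f)"
    using a b f
    by (simp add: eq free_span_diff free_span_cscale second_quant_fock stage_act_fock second_quant_linear pm.scale_right_diff_distrib mult.commute)
  also have "\<dots> = stage_act r N (gr_bracket a b) f"
    using a b f by (simp add: eq gr_bracket_closed second_quant_mcoef_bracket top_char_linear(3))
  finally show "stage_act r N (gr_bracket a b) f = stage_act r N a (stage_act r N b f) - stage_act r N b (stage_act r N a f)"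
    by simp
qed

lemma second_quant_card:
  assumes "finite W" "f \<in> free_span {S. S \<subseteq> W \<and> card S = m}"
  shows "second_quant W A f \<in> free_span {S. S \<subseteq> W \<and> card S = m}"
proof -
  have "second_quant W A (Poly_Mapping.single S 1) \<in> free_span {S. S \<subseteq> W \<and> card S = m}"
    if S: "S \<subseteq> W" "card S = m" for S
  proof -
    have fin: "finite S" using S assms finite_subset by blast
    have "card (insert q (S - {p})) = card S" if "p \<in> S" "q \<notin> S" for p q
      using that fin by (metis Diff_iff card.insert_remove card_Suc_Diff1 finite_Diff insert_Diff_single insert_absorb card_insert_disjoint)
    then have "create q (annih p (Poly_Mapping.single S 1)) \<in> free_span {S. S \<subseteq> W \<and> card S = m}"
      if "q \<in> W" for p q
      using fin S that by (cases "q = p") (auto simp: create_annih_same create_annih_replace intro!: free_span_single)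
    then show ?thesis
      unfolding second_quant_def by (auto intro!: free_span_sum free_span_cscale)
  qed
  then show ?thesis
    unfolding second_quant_lin[of W A f] by (rule free_span_lin) (use assms(2) in \<open>auto simp: free_span_def subset_iff\<close>)
qed

lemma stage_act_stage_space:
  assumes "f \<in> stage_space r N m" "a \<in> gr_carrier r"
  shows "ext_act (int N) a f \<in> stage_space r N m" "stage_act r N a f \<in> stage_space r N m"
proof -
  obtain M where f: "f \<in> fock (window M (int N) r)" using stage_space_window[OF assms(1)] .
  let ?B = "{S. S \<subseteq> window M (int N) r \<and> card S = m}"
  have sub: "free_span ?B \<subseteq> stage_space r N m"
    unfolding stage_space_def
    by (rule free_span_mono) (use window_subset_below finite_subset[OF _ finite_window] in blast)
  have "f \<in> free_span ?B" using f assms(1) by (auto simp: free_span_def stage_space_def)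
  then have "second_quant (window M (int N) r) (mcoef a) f \<in> free_span ?B"
    by (rule second_quant_card[OF finite_window])
  then show ext: "ext_act (int N) a f \<in> stage_space r N m"
    using sub ext_act_second_quant[OF f assms(2)] by auto
  show "stage_act r N a f \<in> stage_space r N m"
    unfolding stage_act_def
    using ext assms(1) unfolding stage_space_def by (intro free_span_add free_span_cscale)
qed

section \<open>Cyclic submodules\<close>

lemma cyclic_span_minimal:
  assumes "pm.subspace W" "v \<in> W" "\<And>a u. a \<in> gr_carrier r \<Longrightarrow> u \<in> W \<Longrightarrow> \<rho> a u \<in> W"
  shows "cyclic_span r \<rho> v \<subseteq> W"
  unfolding cyclic_span_def
proof (rule pm.span_minimal[OF _ assms(1)])
  have "foldr \<rho> as v \<in> W" if "set as \<subseteq> gr_carrier r" for as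
    using that by (induction as) (auto intro: assms)
  then show "{foldr \<rho> as v |as. set as \<subseteq> gr_carrier r} \<subseteq> W" by auto
qed

lemma cyclic_span_generator: "v \<in> cyclic_span r \<rho> v"
  unfolding cyclic_span_def
  by (rule pm.span_base) (auto intro: exI[of _ "[]"])

lemma cyclic_span_act:
  assumes add: "\<And>a f g. \<rho> a (f + g) = \<rho> a f + \<rho> a g"
    and scale: "\<And>a c f. \<rho> a (cscale c f) = cscale c (\<rho> a f)"
    and "a \<in> gr_carrier r" "u \<in> cyclic_span r \<rho> v"
  shows "\<rho> a u \<in> cyclic_span r \<rho> v"
  using assms(4) unfolding cyclic_span_def
proof (induction rule: pm.span_induct_alt)
  case base
  have "\<rho> a 0 = 0" using scale[of a 0 0] by simp
  then show ?case by (simp add: pm.span_zero)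
next
  case (step c x y)
  then obtain as where as: "x = foldr \<rho> as v" "set as \<subseteq> gr_carrier r" by auto
  then have "\<rho> a x \<in> pm.span {foldr \<rho> as v |as. set as \<subseteq> gr_carrier r}"
    using assms(3) by (intro pm.span_base) (auto intro!: exI[of _ "a # as"])
  then show ?case using step by (simp add: add scale pm.span_add pm.span_scale)
qed

lemma subspace_free_span: "pm.subspace (free_span B)"
  by (auto simp: pm.subspace_def free_span_add free_span_cscale)

lemma ext_act_linear:
  "ext_act N a (f + g) = ext_act N a f + ext_act N a g"
  "ext_act N a (cscale c f) = cscale c (ext_act N a f)"
  by (simp_all add: ext_act_lin lin_ext_add lin_ext_cscale)

section \<open>Moving one wedge factor\<close>

text \<open>
  The element \<open>X\<^sup>k \<Prod> (Y - m)\<close>, with \<open>m\<close> ranging over \<open>A\<close>.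
\<close>

lemma xy_shift_interpolation:
  assumes "finite A"
  shows "\<exists>x. \<forall>i. xy_act x (Poly_Mapping.single i 1) = Poly_Mapping.single (i + int k) (\<Prod>m\<in>A. of_int (i - m))"
proof -
  have "\<exists>y. \<forall>i. xy_act y (Poly_Mapping.single i 1) = Poly_Mapping.single i (\<Prod>m\<in>A. of_int (i - m))"
    using assms
  proof (induction A)
    case empty
    show ?case by (intro exI[of _ 1]) (simp add: xy_act_ring)
  next
    case (insert m A)
    then obtain y where y: "\<And>i. xy_act y (Poly_Mapping.single i 1) = Poly_Mapping.single i (\<Prod>m\<in>A. of_int (i - m))"
      by blast
    have "xy_act ((xy_Y + xy_const (- of_int m)) * y) (Poly_Mapping.single i 1) =
        Poly_Mapping.single i (\<Prod>m\<in>insert m A. of_int (i - m))" for i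
      using insert.hyps
      by (simp add: xy_act_ring y xy_act_generators flip: single_add) (simp add: algebra_simps)
    then show ?case by blast
  qed
  then obtain y where y: "\<And>i. xy_act y (Poly_Mapping.single i 1) = Poly_Mapping.single i (\<Prod>m\<in>A. of_int (i - m))"
    by blast
  have "xy_act (xy_X ^ k * y) (Poly_Mapping.single i 1) = Poly_Mapping.single (i + int k) (\<Prod>m\<in>A. of_int (i - m))" for i
    by (induction k) (simp_all add: xy_act_ring y xy_act_generators mult.assoc algebra_simps)
  then show ?thesis by blast
qed

text \<open>
  Let \<open>f\<close> be the polynomial vanishing at all degrees of the window other than that of \<open>p\<close>. On the
  window, \<open>X\<^sup>k f(Y)\<close> times a matrix unit is then a nonzero multiple of the elementary matrix taking
  \<open>p\<close> to \<open>q\<close>.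
\<close>

lemma move_factor:
  assumes S: "S \<subseteq> window M (int N) r" and p: "p \<in> S" and q: "q \<in> window M (int N) r" "q \<notin> S"
    and le: "fst p \<le> fst q"
  obtains a c where "a \<in> gr_carrier r" "c \<noteq> 0"
    "ext_act (int N) a (Poly_Mapping.single S 1) = Poly_Mapping.single (insert q (S - {p})) c"
proof -
  let ?W = "window M (int N) r"
  obtain i j where pp: "p = (i, j)" by (cases p)
  obtain m l where qq: "q = (m, l)" by (cases q)
  have bounds: "M \<le> i" "i < int N" "j < r" "m < int N" "l < r" "i \<le> m"
    using S p q le by (auto simp: pp qq window_def)
  let ?A = "{M..<int N} - {i}"
  define d where "d = (\<Prod>m\<in>?A. of_int (i - m) :: complex)"
  have d: "d \<noteq> 0" unfolding d_def by (subst prod_zero_iff) auto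
  obtain x where x: "\<And>t. xy_act x (Poly_Mapping.single t 1) =
      Poly_Mapping.single (t + int (nat (m - i))) (\<Prod>s\<in>?A. of_int (t - s))"
    using xy_shift_interpolation[of ?A "nat (m - i)"] by auto
  define a where "a = mat r r (\<lambda>(j', j''). if j' = l \<and> j'' = j then x else 0)"
  have a: "a \<in> gr_carrier r" by (simp add: a_def)
  have "mcoef a t s = (if t = q \<and> s = p then d else 0)" if st: "s \<in> ?W" "t \<in> ?W" for s t
  proof -
    obtain i1 j1 where s: "s = (i1, j1)" by (cases s)
    obtain i2 j2 where t: "t = (i2, j2)" by (cases t)
    have b: "j1 < r" "j2 < r" "M \<le> i1" "i1 < int N" using st by (auto simp: s t window_def)
    have vanish: "(\<Prod>s\<in>?A. of_int (i1 - s) :: complex) = 0" if "i1 \<noteq> i"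
      by (rule prod_zero) (use that b in auto)
    show ?thesis
      using b bounds vanish
      by (auto simp: mcoef_entry s t pp qq a_def xy_act_ring x lookup_single when_def d_def)
  qed
  then have "second_quant ?W (mcoef a) (Poly_Mapping.single S 1) =
      second_quant ?W (\<lambda>t s. if t = q \<and> s = p then d else 0) (Poly_Mapping.single S 1)"
    by (intro second_quant_cong) auto
  also have "\<dots> = (\<Sum>t\<in>?W. if t = q then (\<Sum>s\<in>?W. if s = p then cscale d (create q (annih p (Poly_Mapping.single S 1))) else 0) else 0)"
    unfolding second_quant_def sum_over_product prod.case
  proof (rule sum.cong[OF HOL.refl])
    fix t
    have "(\<Sum>s\<in>?W. cscale (if t = q \<and> s = p then d else 0) (create t (annih s (Poly_Mapping.single S 1)))) =
      (\<Sum>s\<in>?W. if t = q \<and> s = p then cscale d (create q (annih p (Poly_Mapping.single S 1))) else 0)"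
      by (rule sum.cong) auto
    then show "(\<Sum>s\<in>?W. cscale (if t = q \<and> s = p then d else 0) (create t (annih s (Poly_Mapping.single S 1)))) =
      (if t = q then (\<Sum>s\<in>?W. if s = p then cscale d (create q (annih p (Poly_Mapping.single S 1))) else 0) else 0)"
      by simp
  qed
  also have "\<dots> = cscale d (create q (annih p (Poly_Mapping.single S 1)))"
    using p q subsetD[OF S p] by simp
  also have "\<dots> = Poly_Mapping.single (insert q (S - {p})) (d * inv_sign p S * inv_sign q (S - {p}))"
    using p q by (simp add: annih_single create_single create_linear mult.assoc)
  finally have "ext_act (int N) a (Poly_Mapping.single S 1) =
      Poly_Mapping.single (insert q (S - {p})) (d * inv_sign p S * inv_sign q (S - {p}))"
    using S a by (simp add: ext_act_second_quant[of _ M N r] free_span_single)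
  moreover have "d * inv_sign p S * inv_sign q (S - {p}) \<noteq> 0"
    using d by (simp add: inv_sign_def)
  ultimately show ?thesis using that a by blast
qed

section \<open>Dominance of index sets\<close>

text \<open>
  For finite sets of the same size this is equivalent to the existence of a bijection from \<open>S\<close> to \<open>T\<close> along which degrees do not
  decrease. The counting form survives the removal of the common elements of \<open>S\<close> and \<open>T\<close>, so that each
  element can be moved directly to a place that is still free.
\<close>

definition dominated :: "idx set \<Rightarrow> idx set \<Rightarrow> bool" where
  "dominated S T \<longleftrightarrow> (\<forall>t. card {p\<in>S. t \<le> fst p} \<le> card {p\<in>T. t \<le> fst p})"

text \<open>
  Move a point \<open>p\<close> of maximal degree in \<open>S - T\<close>. Counting above the degree of \<open>p\<close> yields a free place \<open>q\<close>
  of \<open>T\<close> that is at least as high. Above that degree the new set lies inside \<open>T\<close> by maximality, so it is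
  still dominated by \<open>T\<close>.
\<close>

lemma dominated_induct [consumes 4, case_names start step]:
  assumes "finite S" "finite T" "card S = card T" "dominated S T"
    and "P S"
    and step: "\<And>S p q. finite S \<Longrightarrow> P S \<Longrightarrow> p \<in> S \<Longrightarrow> q \<in> T \<Longrightarrow> q \<notin> S \<Longrightarrow> fst p \<le> fst q \<Longrightarrow> P (insert q (S - {p}))"
  shows "P T"
  using assms(1,3,4,5)
proof (induction "card (S - T)" arbitrary: S rule: less_induct)
  case less
  show ?case
  proof (cases "S \<subseteq> T")
    case True
    then have "S = T" using less.prems assms(2) by (simp add: card_subset_eq)
    then show ?thesis using less.prems by simp
  next
    case False
    let ?D = "S - T"
    have D: "finite ?D" "?D \<noteq> {}" using False less.prems by auto
    then have "Max (fst ` ?D) \<in> fst ` ?D" by (intro Max_in) auto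
    then obtain p where p: "p \<in> ?D" and pmax: "fst p = Max (fst ` ?D)" by auto
    have p_max: "fst x \<le> fst p" if "x \<in> ?D" for x
      unfolding pmax using that D by (intro Max_ge) auto
    have "\<exists>q\<in>T - S. fst p \<le> fst q"
    proof (rule ccontr)
      assume "\<not> ?thesis"
      then have "{x\<in>T. fst p \<le> fst x} \<subset> {x\<in>S. fst p \<le> fst x}" using p by auto
      then have "card {x\<in>T. fst p \<le> fst x} < card {x\<in>S. fst p \<le> fst x}"
        using less.prems by (intro psubset_card_mono) auto
      then show False using less.prems(3)[unfolded dominated_def, rule_format, of "fst p"] by linarith
    qed
    then obtain q where q: "q \<in> T" "q \<notin> S" "fst p \<le> fst q" by auto
    let ?S' = "insert q (S - {p})"
    have fin: "finite ?S'" using less.prems by simp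
    have same_card: "card (insert q (A - {p})) = card A" if "finite A" "p \<in> A" "q \<notin> A" for A
      using that by (metis Diff_iff card_Suc_Diff1 card_insert_disjoint finite_Diff)
    have dom: "dominated ?S' T"
      unfolding dominated_def
    proof
      fix t
      show "card {x\<in>?S'. t \<le> fst x} \<le> card {x\<in>T. t \<le> fst x}"
      proof (cases "t \<le> fst p")
        case True
        then have "{x\<in>?S'. t \<le> fst x} = insert q ({x\<in>S. t \<le> fst x} - {p})" using q by auto
        then have "card {x\<in>?S'. t \<le> fst x} = card {x\<in>S. t \<le> fst x}"
          using same_card[of "{x\<in>S. t \<le> fst x}"] p q True less.prems by auto
        then show ?thesis using less.prems(3) by (simp add: dominated_def)
      next
        case False
        then have "{x\<in>?S'. t \<le> fst x} \<subseteq> {x\<in>T. t \<le> fst x}" using q p_max by force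
        then show ?thesis using assms(2) by (intro card_mono) auto
      qed
    qed
    have "?S' - T = ?D - {p}" using q by auto
    then have "card (?S' - T) < card ?D" using D p by (metis card_Diff1_less)
    moreover have "card ?S' = card T" using same_card[of S] p q less.prems by auto
    moreover have "P ?S'" using step[of S p q] less.prems p q by auto
    ultimately show ?thesis using less.hyps[of ?S'] fin dom by blast
  qed
qed

section \<open>Monomials in the cyclic submodules\<close>

text \<open>
  The index set of the generating monomial of \<open>\<V>(m\<epsilon>\<^sub>1, N)\<close>.
\<close>

definition generator_set :: "nat \<Rightarrow> nat \<Rightarrow> idx set" where
  "generator_set N m = {int N - int m..<int N} \<times> {0}"

definition stage_carrier :: "nat \<Rightarrow> nat \<Rightarrow> nat \<Rightarrow> ext set" where
  "stage_carrier r N m = cyclic_span r (ext_act (int N)) (v_vec r (eps1_times r m) (int N))"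

lemma finite_generator_set [simp]: "finite (generator_set N m)"
  by (simp add: generator_set_def)

lemma card_generator_set [simp]: "card (generator_set N m) = m"
  by (simp add: generator_set_def card_cartesian_product)

lemma generator_set_below: "r > 0 \<Longrightarrow> generator_set N m \<subseteq> below r N"
  by (auto simp: generator_set_def below_def)

lemma sorted_wrt_upto: "sorted_wrt (<) [i..j]"
  by (simp add: strict_sorted_iff)

lemma v_vec_eps1:
  assumes "r > 0"
  shows "v_vec r (eps1_times r m) (int N) = Poly_Mapping.single (generator_set N m) 1"
proof -
  let ?ps = "map (\<lambda>i. (i, 0::nat)) [int N - int m..int N - 1]"
  have "concat (map (\<lambda>j. map (\<lambda>i. ugen (i, j)) [int N - int (eps1_times r m ! j)..int N - 1]) [Suc 0..<r]) = []"
    by (auto simp: eps1_times_def nth_Cons split: nat.split)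
  then have "concat (map (\<lambda>j. map (\<lambda>i. ugen (i, j)) [int N - int (eps1_times r m ! j)..int N - 1]) [0..<r]) = map ugen ?ps"
    by (simp only: upt_conv_Cons[OF assms] list.map concat.simps append_Nil2) (simp add: eps1_times_def)
  moreover have "sorted_wrt (<) ?ps"
    using sorted_wrt_upto by (simp add: sorted_wrt_map less_prod_def)
  moreover have "set ?ps = generator_set N m"
    by (auto simp: generator_set_def)
  ultimately show ?thesis
    unfolding v_vec_def by (metis wedge_list_sorted)
qed

lemma stage_carrier_act: "a \<in> gr_carrier r \<Longrightarrow> u \<in> stage_carrier r N m \<Longrightarrow> ext_act (int N) a u \<in> stage_carrier r N m"
  unfolding stage_carrier_def by (rule cyclic_span_act) (simp_all add: ext_act_linear)

lemma subspace_stage_carrier: "pm.subspace (stage_carrier r N m)"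
  unfolding stage_carrier_def cyclic_span_def by (rule pm.subspace_span)

lemma stage_carrier_subset:
  assumes "r > 0"
  shows "stage_carrier r N m \<subseteq> stage_space r N m"
  unfolding stage_carrier_def
proof (rule cyclic_span_minimal)
  show "pm.subspace (stage_space r N m)" unfolding stage_space_def by (rule subspace_free_span)
  show "v_vec r (eps1_times r m) (int N) \<in> stage_space r N m"
    using assms generator_set_below by (auto simp: v_vec_eps1 stage_space_def intro!: free_span_single)
qed (rule stage_act_stage_space)

text \<open>
  Each of the moves leading from the generator to \<open>T\<close> is the action of an element of \<open>\<G>\<^sub>r\<close> up to a nonzero
  factor, so the chain stays inside the cyclic submodule.
\<close>

lemma stage_carrier_dominating:
  assumes r: "r > 0" and T: "finite T" "T \<subseteq> below r N" "card T = m" and dom: "dominated (generator_set N m) T"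
  shows "Poly_Mapping.single T 1 \<in> stage_carrier r N m"
proof -
  have "Poly_Mapping.single T 1 \<in> stage_carrier r N m \<and> T \<subseteq> below r N"
  proof (rule dominated_induct[of "generator_set N m" T "\<lambda>S. Poly_Mapping.single S 1 \<in> stage_carrier r N m \<and> S \<subseteq> below r N"])
    show "Poly_Mapping.single (generator_set N m) 1 \<in> stage_carrier r N m \<and> generator_set N m \<subseteq> below r N"
      using r generator_set_below cyclic_span_generator[of "Poly_Mapping.single (generator_set N m) 1"]
      by (auto simp: stage_carrier_def v_vec_eps1)
  next
    fix S p q
    assume S: "finite S" "Poly_Mapping.single S 1 \<in> stage_carrier r N m \<and> S \<subseteq> below r N"
      and pq: "p \<in> S" "q \<in> T" "q \<notin> S" "fst p \<le> fst q"
    have "finite (insert q S)" "insert q S \<subseteq> below r N" using S pq T by auto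
    then obtain M where M: "insert q S \<subseteq> window M (int N) r"
      by (rule finite_below_window)
    obtain a c where a: "a \<in> gr_carrier r" "c \<noteq> 0"
      "ext_act (int N) a (Poly_Mapping.single S 1) = Poly_Mapping.single (insert q (S - {p})) c"
      by (rule move_factor[of S M N r p q]) (use M pq in auto)
    then have "cscale (1 / c) (Poly_Mapping.single (insert q (S - {p})) c) \<in> stage_carrier r N m"
      using S stage_carrier_act subspace_stage_carrier by (metis pm.subspace_scale)
    then show "Poly_Mapping.single (insert q (S - {p})) 1 \<in> stage_carrier r N m \<and> insert q (S - {p}) \<subseteq> below r N"
      using a pq T S by auto
  qed (use T dom in auto)
  then show ?thesis ..
qed

text \<open>
  At degree \<open>t\<close> the generator has at most \<open>N - t\<close> factors from \<open>t\<close> upwards. Down to \<open>K\<close> all \<open>r\<close> rows of \<open>T\<close>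
  are full and win the count; between \<open>K\<close> and the lowest degree \<open>M\<close> of \<open>T\<close> nothing more is known about
  \<open>T\<close>, and the surplus has to last, which is the hypothesis \<open>large\<close>.
\<close>

lemma generator_set_dominated:
  assumes T: "finite T" "card T = m" "\<And>p. p \<in> T \<Longrightarrow> M \<le> fst p"
    and K: "{K..<int N} \<times> {..<r} \<subseteq> T" and r: "r > 0"
    and large: "int N - M \<le> int r * (int N - K)"
  shows "dominated (generator_set N m) T"
  unfolding dominated_def
proof
  fix t
  let ?G = "{p\<in>generator_set N m. t \<le> fst p}" and ?T = "{p\<in>T. t \<le> fst p}"
  have "?G \<subseteq> {t..<int N} \<times> {0}" by (auto simp: generator_set_def)
  then have "card ?G \<le> card ({t..<int N} \<times> {0::nat})" by (intro card_mono) auto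
  then have G: "card ?G \<le> nat (int N - t)" by (simp add: card_cartesian_product)
  show "card ?G \<le> card ?T"
  proof (cases "t \<le> M")
    case True
    then have "?T = T" using T(3) by fastforce
    moreover have "card ?G \<le> card (generator_set N m)" by (intro card_mono) auto
    ultimately show ?thesis using T by simp
  next
    case False
    let ?s = "max t K"
    have "{?s..<int N} \<times> {..<r} \<subseteq> ?T" using K by auto
    then have "card ({?s..<int N} \<times> {..<r}) \<le> card ?T" using T by (intro card_mono) auto
    then have le: "nat (int N - ?s) * r \<le> card ?T" by (simp add: card_cartesian_product)
    have "nat (int N - t) \<le> nat (int N - ?s) * r"
    proof (cases "t \<le> K")
      case True
      have "int N - t \<le> int r * (int N - K)" using False large by linarith
      then have "nat (int N - t) \<le> nat (int r * (int N - K))" by (rule nat_mono)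
      then show ?thesis using True by (simp add: nat_mult_distrib mult.commute max_def)
    next
      case False
      then show ?thesis using r by (simp add: max_def)
    qed
    then show ?thesis using G le by linarith
  qed
qed

section \<open>The embeddings of the system\<close>

definition level :: "nat \<Rightarrow> nat \<Rightarrow> idx set" where
  "level r N = {int N} \<times> {..<r}"

lemma level_properties: "finite (level r N)" "card (level r N) = r" "below r N \<inter> level r N = {}"
    "below r N \<union> level r N = below r (Suc N)" "level r N \<union> sea r (Suc N) = sea r N"
  by (auto simp: level_def below_def sea_def card_cartesian_product)

lemma V_embed_lin:
  assumes "u \<in> fock (below r N)"
  shows "V_embed r N u = lin_ext (\<lambda>S. Poly_Mapping.single (S \<union> level r N) 1) u"
proof -
  have "map (\<lambda>j. ugen (int N, j)) [0..<r] = map ugen (map (Pair (int N)) [0..<r])" by simp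
  moreover have "sorted_wrt (<) (map (Pair (int N)) [0..<r])"
    by (simp add: sorted_wrt_map less_prod_def)
  moreover have "set (map (Pair (int N)) [0..<r]) = level r N"
    by (auto simp: level_def)
  ultimately have top: "wedge_list (map (\<lambda>j. ugen (int N, j)) [0..<r]) = Poly_Mapping.single (level r N) 1"
    by (metis wedge_list_sorted)
  have "wedge_mono S (level r N) = Poly_Mapping.single (S \<union> level r N) 1" if "S \<subseteq> below r N" for S
  proof -
    have "{(s, t). s \<in> S \<and> t \<in> level r N \<and> t < s} = {}"
      using that by (auto simp: level_def below_def less_prod_def)
    moreover have "S \<inter> level r N = {}" using that level_properties(3) by blast
    ultimately show ?thesis by (simp only: wedge_mono_def if_True card.empty power_0 simp_thms)
  qed
  then show ?thesis
    unfolding V_embed_def top wedge_lin using assms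
    by (intro lin_ext_cong) (auto simp: free_span_def)
qed

lemma V_embed_stage_space:
  assumes "u \<in> stage_space r N m"
  shows "V_embed r N u \<in> stage_space r (Suc N) (m + r)"
proof -
  have u: "u \<in> fock (below r N)" using assms stage_space_below by blast
  show ?thesis
    unfolding V_embed_lin[OF u] unfolding stage_space_def
  proof (intro free_span_lin free_span_single)
    fix S assume "S \<in> Poly_Mapping.keys u"
    then have "finite S" "S \<subseteq> below r N" "card S = m" using assms by (auto simp: stage_space_def free_span_def)
    moreover from this have "S \<inter> level r N = {}" using level_properties(3) by blast
    ultimately show "S \<union> level r N \<in> {S. finite S \<and> S \<subseteq> below r (Suc N) \<and> card S = m + r}"
      using level_properties[of r N] by (auto simp: card_Un_disjoint)
  qed
qed

lemma fill_sea_V_embed: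
  assumes "u \<in> stage_space r N m"
  shows "fill_sea r (Suc N) (V_embed r N u) = fill_sea r N u"
proof -
  have u: "u \<in> fock (below r N)" using assms stage_space_below by blast
  show ?thesis
    unfolding V_embed_lin[OF u]
    by (simp add: fill_sea_def lin_ext_compose Un_assoc level_properties)
qed

lemma V_embed_linear:
  "V_embed r N (f + g) = V_embed r N f + V_embed r N g"
  "V_embed r N (cscale c f) = cscale c (V_embed r N f)"
  by (simp_all add: V_embed_def wedge_lin lin_ext_add lin_ext_cscale)

lemma semi_act_stage:
  assumes "u \<in> stage_space r N m" "a \<in> gr_carrier r"
  shows "semi_act r a (fill_sea r N u) = fill_sea r N (stage_act r N a u)"
proof -
  obtain M where "u \<in> fock (window M (int N) r)" using stage_space_window[OF assms(1)] .
  then show ?thesis using assms(2) by (rule semi_act_fill_sea)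
qed

lemma inj_on_fill_sea_stage: "inj_on (fill_sea r N) (stage_space r N m)"
  by (rule inj_on_subset[OF inj_on_fill_sea stage_space_below])

text \<open>
  Filling the sea is injective, so it suffices to compare the semi-infinite forms, which do not see
  the stage.
\<close>

lemma V_embed_stage_act:
  assumes "u \<in> stage_space r N m" "a \<in> gr_carrier r"
  shows "V_embed r N (stage_act r N a u) = stage_act r (Suc N) a (V_embed r N u)"
proof (rule inj_onD[OF inj_on_fill_sea_stage])
  have v: "V_embed r N u \<in> stage_space r (Suc N) (m + r)" using assms(1) by (rule V_embed_stage_space)
  have au: "stage_act r N a u \<in> stage_space r N m" using assms by (rule stage_act_stage_space)
  show "V_embed r N (stage_act r N a u) \<in> stage_space r (Suc N) (m + r)"
    using au by (rule V_embed_stage_space)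
  show "stage_act r (Suc N) a (V_embed r N u) \<in> stage_space r (Suc N) (m + r)"
    using v assms(2) by (rule stage_act_stage_space)
  show "fill_sea r (Suc N) (V_embed r N (stage_act r N a u)) = fill_sea r (Suc N) (stage_act r (Suc N) a (V_embed r N u))"
    by (simp add: fill_sea_V_embed[OF au] fill_sea_V_embed[OF assms(1)]
        semi_act_stage[OF v assms(2), symmetric] semi_act_stage[OF assms, symmetric])
qed

text \<open>
  Passing to stage \<open>N + 1\<close>, the generator takes one place of degree \<open>N\<close> and \<open>r - 1\<close> places below the old
  ones, whereas the image of the old generator takes all its \<open>r\<close> new places in degree \<open>N\<close>.
\<close>

lemma generator_set_level_dominated:
  assumes "r > 0"
  shows "dominated (generator_set (Suc N) (m + r)) (generator_set N m \<union> level r N)"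
  unfolding dominated_def
proof
  fix t
  let ?G = "{p\<in>generator_set (Suc N) (m + r). t \<le> fst p}" and ?U = "generator_set N m \<union> level r N"
  let ?T = "{p\<in>?U. t \<le> fst p}"
  have disj: "generator_set N m \<inter> level r N = {}" by (auto simp: generator_set_def level_def)
  have fin: "finite ?U" by (simp add: level_properties)
  show "card ?G \<le> card ?T"
  proof (cases "t < int N - int m")
    case True
    then have "?T = ?U" by (auto simp: generator_set_def level_def)
    then have "card ?T = m + r"
      using disj by (simp only: card_Un_disjoint finite_generator_set level_properties card_generator_set)
    moreover have "card ?G \<le> card (generator_set (Suc N) (m + r))" by (intro card_mono) auto
    ultimately show ?thesis by simp
  next
    case False
    show ?thesis
    proof (cases "t \<le> int N")
      case True
      have "?G \<subseteq> {t..int N} \<times> {0}" by (auto simp: generator_set_def)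
      then have "card ?G \<le> card ({t..int N} \<times> {0::nat})" by (intro card_mono) auto
      also have "\<dots> \<le> card ?T"
        by (rule card_mono) (use fin False assms in \<open>auto simp: generator_set_def level_def\<close>)
      finally show ?thesis .
    next
      case False
      then have "?G = {}" by (auto simp: generator_set_def)
      then show ?thesis by (simp only: card.empty le0)
    qed
  qed
qed

text \<open>
  The image of the generator is in the target by dominance, and \<open>V_embed\<close> intertwines the untwisted
  actions up to scalars.
\<close>

lemma V_embed_stage_carrier:
  assumes r: "r > 0" and u: "u \<in> stage_carrier r N m"
  shows "V_embed r N u \<in> stage_carrier r (Suc N) (m + r)"
proof -
  let ?W = "{u \<in> stage_space r N m. V_embed r N u \<in> stage_carrier r (Suc N) (m + r)}"
  let ?C = "stage_carrier r (Suc N) (m + r)"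
  have C: "pm.subspace ?C" by (rule subspace_stage_carrier)
  have "cyclic_span r (ext_act (int N)) (v_vec r (eps1_times r m) (int N)) \<subseteq> ?W"
  proof (rule cyclic_span_minimal)
    have "V_embed r N 0 = 0" using V_embed_linear(2)[of r N 0 0] by simp
    moreover have "pm.subspace (stage_space r N m)" unfolding stage_space_def by (rule subspace_free_span)
    ultimately show "pm.subspace ?W"
      using C by (auto simp: pm.subspace_def V_embed_linear)
    have g: "generator_set N m \<subseteq> below r N" using r by (rule generator_set_below)
    then have s: "Poly_Mapping.single (generator_set N m) 1 \<in> stage_space r N m"
      by (auto simp: stage_space_def intro: free_span_single)
    have "Poly_Mapping.single (generator_set N m \<union> level r N) 1 \<in> ?C"
    proof (rule stage_carrier_dominating[OF r])
      have "generator_set N m \<inter> level r N = {}" by (auto simp: generator_set_def level_def)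
      then show "card (generator_set N m \<union> level r N) = m + r"
        by (simp add: card_Un_disjoint level_properties)
      show "generator_set N m \<union> level r N \<subseteq> below r (Suc N)"
        using g level_properties(4)[of r N] by blast
    qed (use generator_set_level_dominated[OF r] level_properties in auto)
    then show "v_vec r (eps1_times r m) (int N) \<in> ?W"
      using s stage_space_below[of r N m] r by (auto simp: v_vec_eps1 V_embed_lin)
  next
    fix a v assume a: "a \<in> gr_carrier r" and v: "v \<in> ?W"
    have ext: "ext_act (int K) a w = stage_act r K a w + cscale (top_char r K a) w" for K w
      by (simp add: stage_act_def)
    have "V_embed r N (ext_act (int N) a v) = ext_act (int (Suc N)) a (V_embed r N v)
       - cscale (top_char r (Suc N) a) (V_embed r N v) + cscale (top_char r N a) (V_embed r N v)"
      unfolding ext using v a by (simp add: V_embed_linear V_embed_stage_act[of v r N m a])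
    also have "\<dots> \<in> ?C"
      using v a by (intro pm.subspace_add[OF C] pm.subspace_diff[OF C] pm.subspace_scale[OF C] stage_carrier_act) auto
    finally show "ext_act (int N) a v \<in> ?W"
      using a v stage_act_stage_space(1) by auto
  qed
  then show ?thesis using u by (auto simp: stage_carrier_def)
qed

section \<open>Modules inside free vector spaces\<close>

lemma abelian_group_free_gr_module:
  assumes "pm.subspace W"
  shows "abelian_group (free_gr_module W \<rho>)"
proof (rule abelian_groupI)
  fix x assume "x \<in> carrier (free_gr_module W \<rho>)"
  then have "cscale (-1) x \<in> W"
    using assms by (simp add: free_gr_module_def pm.subspace_scale del: pm.scale_minus_left)
  moreover have "cscale (-1) x + x = 0" by simp
  ultimately show "\<exists>y\<in>carrier (free_gr_module W \<rho>). y \<oplus>\<^bsub>free_gr_module W \<rho>\<^esub> x = \<zero>\<^bsub>free_gr_module W \<rho>\<^esub>"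
    by (intro bexI[of _ "cscale (-1) x"]) (simp_all add: free_gr_module_def)
qed (use assms in \<open>auto simp: free_gr_module_def pm.subspace_def ac_simps\<close>)

lemma module_free_gr_module:
  assumes "pm.subspace W"
  shows "Module.module class_ring (free_gr_module W \<rho>)"
proof (rule moduleI)
  show "cring (class_ring :: complex ring)" by (rule class_cring.cring_axioms)
  show "abelian_group (free_gr_module W \<rho>)" using assms by (rule abelian_group_free_gr_module)
qed (use assms in \<open>auto simp: free_gr_module_def pm.subspace_scale
    pm.scale_left_distrib pm.scale_right_distrib\<close>)

lemma is_gr_module_free:
  assumes W: "pm.subspace W"
    and closed: "\<And>a v. a \<in> gr_carrier r \<Longrightarrow> v \<in> W \<Longrightarrow> \<rho> a v \<in> W"
    and add: "\<And>a v w. a \<in> gr_carrier r \<Longrightarrow> v \<in> W \<Longrightarrow> w \<in> W \<Longrightarrow> \<rho> a (v + w) = \<rho> a v + \<rho> a w"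
    and scale: "\<And>a c v. a \<in> gr_carrier r \<Longrightarrow> v \<in> W \<Longrightarrow> \<rho> a (cscale c v) = cscale c (\<rho> a v)"
    and gr: "\<And>a b v. a \<in> gr_carrier r \<Longrightarrow> b \<in> gr_carrier r \<Longrightarrow> v \<in> W \<Longrightarrow> \<rho> (a + b) v = \<rho> a v + \<rho> b v"
      "\<And>a c v. a \<in> gr_carrier r \<Longrightarrow> v \<in> W \<Longrightarrow> \<rho> (xy_const c \<cdot>\<^sub>m a) v = cscale c (\<rho> a v)"
      "\<And>a b v. a \<in> gr_carrier r \<Longrightarrow> b \<in> gr_carrier r \<Longrightarrow> v \<in> W \<Longrightarrow>
         \<rho> (gr_bracket a b) v = \<rho> a (\<rho> b v) - \<rho> b (\<rho> a v)"
  shows "is_gr_module r (free_gr_module W \<rho>)"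
proof -
  let ?M = "free_gr_module W \<rho>"
  have "x \<ominus>\<^bsub>?M\<^esub> y = x - y" if "x \<in> W" "y \<in> W" for x y
  proof -
    have "cscale (-1) y \<in> W" using W that by (rule_tac pm.subspace_scale)
    then have "- y \<in> W" by simp
    then have "\<ominus>\<^bsub>?M\<^esub> y = - y"
      using that by (intro abelian_group.minus_equality[OF abelian_group_free_gr_module[OF W]])
        (simp_all add: free_gr_module_def)
    then show ?thesis by (simp add: a_minus_def) (simp add: free_gr_module_def)
  qed
  then show ?thesis
    using module_free_gr_module[OF W, of \<rho>] assms
    unfolding is_gr_module_def by (auto simp: free_gr_module_def)
qed

text \<open>
  The module axioms are identities, so they pass to a structure that is the image of a module under a
  map respecting all operations.
\<close>

lemma is_gr_module_image:
  assumes L: "is_gr_module r L"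
    and carrier: "carrier M = c ` carrier L"
    and zero: "\<zero>\<^bsub>M\<^esub> = c \<zero>\<^bsub>L\<^esub>"
    and add: "\<And>x y. x \<in> carrier L \<Longrightarrow> y \<in> carrier L \<Longrightarrow> c x \<oplus>\<^bsub>M\<^esub> c y = c (x \<oplus>\<^bsub>L\<^esub> y)"
    and smult: "\<And>k x. x \<in> carrier L \<Longrightarrow> k \<odot>\<^bsub>M\<^esub> c x = c (k \<odot>\<^bsub>L\<^esub> x)"
    and act: "\<And>a x. a \<in> gr_carrier r \<Longrightarrow> x \<in> carrier L \<Longrightarrow> act M a (c x) = c (act L a x)"
  shows "is_gr_module r M"
proof -
  have mod: "Module.module class_ring L" using L by (simp add: is_gr_module_def)
  interpret L: Module.module "class_ring :: complex ring" L by (rule mod)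
  have ab: "abelian_group M"
  proof (rule abelian_groupI)
    fix x assume "x \<in> carrier M"
    then obtain x' where x: "x = c x'" "x' \<in> carrier L" by (auto simp: carrier)
    then have "c (\<ominus>\<^bsub>L\<^esub> x') \<oplus>\<^bsub>M\<^esub> x = \<zero>\<^bsub>M\<^esub>"
      by (simp add: add zero L.M.l_neg)
    then show "\<exists>y\<in>carrier M. y \<oplus>\<^bsub>M\<^esub> x = \<zero>\<^bsub>M\<^esub>"
      using x by (auto simp: carrier)
  qed (auto simp: carrier zero add L.M.a_ac)
  have "Module.module class_ring M"
  proof (rule moduleI)
    show "cring (class_ring :: complex ring)" by (rule class_cring.cring_axioms)
    show "abelian_group M" by (rule ab)
  next
    fix a and x assume "x \<in> carrier M"
    then show "a \<odot>\<^bsub>M\<^esub> x \<in> carrier M"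
      using L.smult_closed by (auto simp: carrier smult)
  next
    fix a b :: complex and x assume "x \<in> carrier M"
    then obtain x' where x: "x = c x'" "x' \<in> carrier L" by (auto simp: carrier)
    show "(a \<oplus>\<^bsub>class_ring\<^esub> b) \<odot>\<^bsub>M\<^esub> x = a \<odot>\<^bsub>M\<^esub> x \<oplus>\<^bsub>M\<^esub> b \<odot>\<^bsub>M\<^esub> x"
      using x L.smult_l_distr[of a b x'] L.smult_closed by (simp add: smult add)
    show "(a \<otimes>\<^bsub>class_ring\<^esub> b) \<odot>\<^bsub>M\<^esub> x = a \<odot>\<^bsub>M\<^esub> (b \<odot>\<^bsub>M\<^esub> x)"
      using x L.smult_assoc1[of a b x'] L.smult_closed by (simp add: smult)
  next
    fix a x y assume "x \<in> carrier M" "y \<in> carrier M"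
    then obtain x' y' where x: "x = c x'" "x' \<in> carrier L" "y = c y'" "y' \<in> carrier L" by (auto simp: carrier)
    show "a \<odot>\<^bsub>M\<^esub> (x \<oplus>\<^bsub>M\<^esub> y) = a \<odot>\<^bsub>M\<^esub> x \<oplus>\<^bsub>M\<^esub> a \<odot>\<^bsub>M\<^esub> y"
      using x L.smult_r_distr[of a x' y'] L.smult_closed by (simp add: smult add)
  next
    fix x assume "x \<in> carrier M"
    then obtain x' where x: "x = c x'" "x' \<in> carrier L" by (auto simp: carrier)
    show "\<one>\<^bsub>class_ring\<^esub> \<odot>\<^bsub>M\<^esub> x = x"
      using x L.smult_one[of x'] by (simp add: smult)
  qed
  moreover have minus: "c x \<ominus>\<^bsub>M\<^esub> c y = c (x \<ominus>\<^bsub>L\<^esub> y)" if "x \<in> carrier L" "y \<in> carrier L" for x y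
  proof -
    have "\<ominus>\<^bsub>M\<^esub> c y = c (\<ominus>\<^bsub>L\<^esub> y)"
      using that by (intro abelian_group.minus_equality[OF ab]) (auto simp: carrier add zero L.M.l_neg)
    then show ?thesis using that by (simp add: a_minus_def add)
  qed
  moreover have "act L a x \<in> carrier L" if "a \<in> gr_carrier r" "x \<in> carrier L" for a x
    using L that by (auto simp: is_gr_module_def)
  moreover have "k \<odot>\<^bsub>L\<^esub> x \<in> carrier L" if "x \<in> carrier L" for k x
    using L.smult_closed that by simp
  ultimately show ?thesis
    using L unfolding is_gr_module_def carrier
    by (simp add: add smult act gr_bracket_closed)
qed

section \<open>Direct limits of modules\<close>

text \<open>
  Two points of the system are identified exactly if they have the same image in \<open>L\<close>. Thus the
  classes are the fibres \<open>cls x\<close> of the joint map to \<open>L\<close>, and the operations on classes computed from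
  representatives are those of \<open>L\<close>.
\<close>

lemma direct_limit_isomorphic:
  assumes sys: "inductive_system r M f" and L: "is_gr_module r L"
    and hom: "\<And>N. \<iota> N \<in> gr_hom r (M N) L"
    and inj: "\<And>N. inj_on (\<iota> N) (carrier (M N))"
    and comp: "\<And>N v. v \<in> carrier (M N) \<Longrightarrow> \<iota> (Suc N) (f N v) = \<iota> N v"
    and surj: "\<And>x. x \<in> carrier L \<Longrightarrow> \<exists>N. x \<in> \<iota> N ` carrier (M N)"
  shows "gr_isomorphic r (direct_limit M f) L"
proof -
  define cls where "cls = (\<lambda>x. {(N, v). v \<in> carrier (M N) \<and> \<iota> N v = x})"
  have mem_cls: "(N, v) \<in> cls x \<longleftrightarrow> v \<in> carrier (M N) \<and> \<iota> N v = x" for N v x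
    by (simp add: cls_def)
  let ?D = "direct_limit M f"
  have M: "is_gr_module r (M N)" for N using sys by (simp add: inductive_system_def)
  have mod: "Module.module class_ring (M N)" for N using M by (simp add: is_gr_module_def)
  note M_closed = abelian_monoid.a_closed[OF abelian_group.axioms(1)[OF module.axioms(2)[OF mod]]]
    module.smult_closed[OF mod, simplified]
  have act_closed: "act (M N) a v \<in> carrier (M N)" if "a \<in> gr_carrier r" "v \<in> carrier (M N)" for N a v
    using M[of N] that by (auto simp: is_gr_module_def)
  have i_closed: "\<iota> N v \<in> carrier L"
    and i_add: "w \<in> carrier (M N) \<Longrightarrow> \<iota> N (v \<oplus>\<^bsub>M N\<^esub> w) = \<iota> N v \<oplus>\<^bsub>L\<^esub> \<iota> N w"
    and i_smult: "\<iota> N (k \<odot>\<^bsub>M N\<^esub> v) = k \<odot>\<^bsub>L\<^esub> \<iota> N v"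
    and i_act: "a \<in> gr_carrier r \<Longrightarrow> \<iota> N (act (M N) a v) = act L a (\<iota> N v)"
    if "v \<in> carrier (M N)" for N v w k a
    using hom[of N] that by (auto simp: gr_hom_def)
  have stage: "sys_map f N k v \<in> carrier (M (N + k)) \<and> \<iota> (N + k) (sys_map f N k v) = \<iota> N v"
    if "v \<in> carrier (M N)" for N k v
  proof (induction k)
    case (Suc k)
    have "f (N + k) \<in> gr_hom r (M (N + k)) (M (Suc (N + k)))"
      using sys by (simp add: inductive_system_def)
    then show ?case using Suc comp[of _ "N + k"] by (auto simp: gr_hom_def)
  qed (use that in simp)
  have rel: "dl_rel M f `` {(N, v)} = cls (\<iota> N v)" if v: "v \<in> carrier (M N)" for N v
  proof -
    have "((N, v), (K, w)) \<in> dl_rel M f \<longleftrightarrow> w \<in> carrier (M K) \<and> \<iota> K w = \<iota> N v" for K w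
    proof
      assume "((N, v), (K, w)) \<in> dl_rel M f"
      then obtain k l where *: "w \<in> carrier (M K)" "N + k = K + l" "sys_map f N k v = sys_map f K l w"
        by (auto simp: dl_rel_def dl_points_def)
      then show "w \<in> carrier (M K) \<and> \<iota> K w = \<iota> N v" using stage[OF v, of k] stage[OF *(1), of l] by simp
    next
      assume w: "w \<in> carrier (M K) \<and> \<iota> K w = \<iota> N v"
      then have "sys_map f N K v = sys_map f K N w"
        using stage[OF v, of K] stage[of w K N] inj_onD[OF inj[of "N + K"]] by (metis add.commute)
      then have "\<exists>k l. N + k = K + l \<and> sys_map f N k v = sys_map f K l w"
        by (metis add.commute)
      then show "((N, v), (K, w)) \<in> dl_rel M f"
        using v w by (auto simp: dl_rel_def dl_points_def)
    qed
    then show ?thesis by (auto simp: cls_def)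
  qed
  have common: "\<exists>N v w. (N, v) \<in> cls x \<and> (N, w) \<in> cls y" if xy: "x \<in> carrier L" "y \<in> carrier L" for x y
  proof -
    obtain N v where v: "v \<in> carrier (M N)" "x = \<iota> N v" using surj[OF xy(1)] by auto
    obtain K w where w: "w \<in> carrier (M K)" "y = \<iota> K w" using surj[OF xy(2)] by auto
    have "(N + K, sys_map f N K v) \<in> cls x" "(N + K, sys_map f K N w) \<in> cls y"
      using stage[OF v(1), of K] stage[OF w(1), of N] v w by (auto simp: cls_def add.commute)
    then show ?thesis by blast
  qed
  have carrier: "carrier ?D = cls ` carrier L"
  proof
    show "carrier ?D \<subseteq> cls ` carrier L"
      by (auto simp: direct_limit_def dl_points_def quotient_def rel i_closed)
    show "cls ` carrier L \<subseteq> carrier ?D"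
    proof
      fix A assume "A \<in> cls ` carrier L"
      then obtain N v where v: "v \<in> carrier (M N)" "A = cls (\<iota> N v)" using surj by blast
      then have "A = dl_rel M f `` {(N, v)}" by (simp add: rel)
      moreover have "(N, v) \<in> dl_points M" using v by (simp add: dl_points_def)
      ultimately show "A \<in> carrier ?D" by (auto simp: direct_limit_def intro: quotientI)
    qed
  qed
  have inj_cls: "inj_on cls (carrier L)"
  proof (rule inj_onI)
    fix x y assume x: "x \<in> carrier L" and "cls x = cls y"
    moreover obtain N v where "(N, v) \<in> cls x" using common[OF x x] by blast
    ultimately have "(N, v) \<in> cls x" "(N, v) \<in> cls y" by auto
    then show "x = y" by (simp add: cls_def)
  qed
  have add: "cls x \<oplus>\<^bsub>?D\<^esub> cls y = cls (x \<oplus>\<^bsub>L\<^esub> y)" if "x \<in> carrier L" "y \<in> carrier L" for x y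
  proof -
    have "dl_rel M f `` {(N, v \<oplus>\<^bsub>M N\<^esub> w)} = cls (x \<oplus>\<^bsub>L\<^esub> y)" if "(N, v) \<in> cls x" "(N, w) \<in> cls y" for N v w
      using that by (auto simp: mem_cls rel M_closed i_add)
    then have "{dl_rel M f `` {(N, v \<oplus>\<^bsub>M N\<^esub> w)} |N v w. (N, v) \<in> cls x \<and> (N, w) \<in> cls y} = {cls (x \<oplus>\<^bsub>L\<^esub> y)}"
      using common[OF \<open>x \<in> carrier L\<close> \<open>y \<in> carrier L\<close>] by blast
    then show ?thesis by (simp add: direct_limit_def)
  qed
  have smult: "k \<odot>\<^bsub>?D\<^esub> cls x = cls (k \<odot>\<^bsub>L\<^esub> x)" if "x \<in> carrier L" for x k
  proof -
    have "dl_rel M f `` {(N, k \<odot>\<^bsub>M N\<^esub> v)} = cls (k \<odot>\<^bsub>L\<^esub> x)" if "(N, v) \<in> cls x" for N v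
      using that by (auto simp: mem_cls rel M_closed i_smult)
    then have "{dl_rel M f `` {(N, k \<odot>\<^bsub>M N\<^esub> v)} |N v. (N, v) \<in> cls x} = {cls (k \<odot>\<^bsub>L\<^esub> x)}"
      using common[OF \<open>x \<in> carrier L\<close> \<open>x \<in> carrier L\<close>] by blast
    then show ?thesis by (simp add: direct_limit_def)
  qed
  have act: "act ?D a (cls x) = cls (act L a x)" if "a \<in> gr_carrier r" "x \<in> carrier L" for x a
  proof -
    have "dl_rel M f `` {(N, act (M N) a v)} = cls (act L a x)" if "(N, v) \<in> cls x" for N v
      using that \<open>a \<in> gr_carrier r\<close> by (auto simp: mem_cls rel act_closed i_act)
    then have "{dl_rel M f `` {(N, act (M N) a v)} |N v. (N, v) \<in> cls x} = {cls (act L a x)}"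
      using common[OF \<open>x \<in> carrier L\<close> \<open>x \<in> carrier L\<close>] by blast
    then show ?thesis by (simp add: direct_limit_def)
  qed
  have zero: "\<zero>\<^bsub>?D\<^esub> = cls \<zero>\<^bsub>L\<^esub>"
  proof -
    have z: "\<zero>\<^bsub>M 0\<^esub> \<in> carrier (M 0)"
      by (rule abelian_monoid.zero_closed[OF abelian_group.axioms(1)[OF module.axioms(2)[OF mod]]])
    have Lmod: "Module.module class_ring L" using L by (simp add: is_gr_module_def)
    have "\<iota> 0 \<zero>\<^bsub>M 0\<^esub> = \<iota> 0 (0 \<odot>\<^bsub>M 0\<^esub> \<zero>\<^bsub>M 0\<^esub>)"
      using module.smult_l_null[OF mod z] by simp
    also have "\<dots> = \<zero>\<^bsub>L\<^esub>"
      using module.smult_l_null[OF Lmod i_closed[OF z]] z by (simp add: i_smult)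
    finally have "\<iota> 0 \<zero>\<^bsub>M 0\<^esub> = \<zero>\<^bsub>L\<^esub>" .
    then show ?thesis using rel[OF z] by (simp add: direct_limit_def)
  qed
  have D: "is_gr_module r ?D"
    by (rule is_gr_module_image[OF L carrier zero add smult act])
  let ?\<phi> = "inv_into (carrier L) cls"
  have bij: "bij_betw cls (carrier L) (carrier ?D)"
    using inj_cls by (simp add: bij_betw_def carrier)
  have L_closed: "x \<oplus>\<^bsub>L\<^esub> y \<in> carrier L" "k \<odot>\<^bsub>L\<^esub> x \<in> carrier L" "a \<in> gr_carrier r \<Longrightarrow> act L a x \<in> carrier L"
    if "x \<in> carrier L" "y \<in> carrier L" for x y k a
  proof -
    have Lmod: "Module.module class_ring L" using L by (simp add: is_gr_module_def)
    show "x \<oplus>\<^bsub>L\<^esub> y \<in> carrier L"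
      using abelian_monoid.a_closed[OF abelian_group.axioms(1)[OF module.axioms(2)[OF Lmod]]] that .
    show "k \<odot>\<^bsub>L\<^esub> x \<in> carrier L" using module.smult_closed[OF Lmod] that by simp
    show "a \<in> gr_carrier r \<Longrightarrow> act L a x \<in> carrier L" using L that by (auto simp: is_gr_module_def)
  qed
  have inv: "?\<phi> (cls x) = x" if "x \<in> carrier L" for x using inj_cls that by (rule inv_into_f_f)
  have "?\<phi> \<in> gr_hom r ?D L"
    unfolding gr_hom_def carrier by (auto simp: inv add smult act L_closed)
  then show ?thesis
    using D L bij_betw_inv_into[OF bij] by (auto simp: gr_isomorphic_def)
qed

section \<open>The module \<open>\<L>\<^sub>n\<close>\<close>

lemma fill_sea_admissible:
  assumes "u \<in> stage_space r N m"
  shows "fill_sea r N u \<in> semi_space r"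
proof -
  have "semi_admissible r (S \<union> sea r N)" if "finite S" "S \<subseteq> below r N" for S
  proof -
    have "sym_diff (S \<union> sea r N) ({0..} \<times> {..<r}) \<subseteq> S \<union> window 0 (int N) r"
      by (auto simp: sea_def window_def)
    moreover have "finite (S \<union> window 0 (int N) r)" using that by simp
    ultimately have "finite (sym_diff (S \<union> sea r N) ({0..} \<times> {..<r}))" by (rule finite_subset)
    moreover have "S \<union> sea r N \<subseteq> UNIV \<times> {..<r}" using that by (auto simp: sea_def below_def)
    ultimately show ?thesis by (simp add: semi_admissible_def)
  qed
  then have "fill_sea r N u \<in> free_span {H. semi_admissible r H}"
    unfolding fill_sea_def
  proof (intro free_span_lin free_span_single)
    fix S assume "S \<in> Poly_Mapping.keys u"
    then have "finite S" "S \<subseteq> below r N" using assms by (auto simp: stage_space_def free_span_def)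
    then show "S \<union> sea r N \<in> {H. semi_admissible r H}"
      using \<open>\<And>S. finite S \<Longrightarrow> S \<subseteq> below r N \<Longrightarrow> semi_admissible r (S \<union> sea r N)\<close> by simp
  qed
  then show ?thesis by (auto simp: semi_space_def free_span_def)
qed

text \<open>
  The identity counts the factors, and \<open>\<delta>\<^sub>N\<close> subtracts the number \<open>N r\<close> of places of degree \<open>0 \<le> i < N\<close>. So
  \<open>\<L>\<^sub>n\<close> is spanned by the monomials that have \<open>n + N r\<close> factors outside the sea.
\<close>

lemma stage_act_one:
  assumes "S \<subseteq> window M (int N) r"
  shows "stage_act r N (1\<^sub>m r) (Poly_Mapping.single S 1) =
    cscale (of_nat (card S) - of_nat (N * r)) (Poly_Mapping.single S 1)"
proof -
  let ?W = "window M (int N) r" and ?u = "Poly_Mapping.single S (1::complex)"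
  have fin: "finite S" using assms by (rule finite_subset) simp
  have snd: "snd p < r" if "p \<in> ?W" for p using that by (auto simp: window_def)
  have "ext_act (int N) (1\<^sub>m r) ?u = second_quant ?W (mcoef (1\<^sub>m r)) ?u"
    using assms by (intro ext_act_second_quant free_span_single) auto
  also have "\<dots> = (\<Sum>q\<in>?W. \<Sum>p\<in>?W. if p = q then create q (annih q ?u) else 0)"
    unfolding second_quant_def sum_over_product prod.case
    by (intro sum.cong HOL.refl) (auto simp: mcoef_one snd)
  also have "\<dots> = (\<Sum>q\<in>?W. if q \<in> S then ?u else 0)"
    using fin by (simp add: create_annih_same)
  also have "\<dots> = (\<Sum>q\<in>S. ?u)"
    using assms by (simp add: sum.inter_restrict[symmetric] Int_absorb1)
  also have "\<dots> = cscale (of_nat (card S)) ?u"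
    by (rule poly_mapping_eqI) (simp add: lookup_sum lookup_single when_def)
  finally have 1: "ext_act (int N) (1\<^sub>m r) ?u = cscale (of_nat (card S)) ?u" .
  have "top_char r N (1\<^sub>m r) = (\<Sum>p\<in>top_set r N. 1)"
    unfolding top_char_sum[OF one_carrier_mat] by (rule sum.cong) (auto simp: top_set_def mcoef_one)
  also have "\<dots> = of_nat (N * r)" by (simp add: top_set_def card_cartesian_product)
  finally have 2: "top_char r N (1\<^sub>m r) = of_nat (N * r)" .
  show ?thesis
    unfolding stage_act_def 1 2 pm.scale_left_distrib[symmetric] by simp
qed

lemma stage_act_one_lin_ext:
  assumes "u \<in> fock (window M (int N) r)"
  shows "stage_act r N (1\<^sub>m r) u = lin_ext (\<lambda>S. cscale (of_nat (card S) - of_nat (N * r)) (Poly_Mapping.single S 1)) u"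
  by (subst stage_act_lin, rule lin_ext_cong, rule stage_act_one) (use assms in \<open>auto simp: free_span_def\<close>)

lemma stage_act_one_stage_space:
  assumes "u \<in> stage_space r N (n + N * r)"
  shows "stage_act r N (1\<^sub>m r) u = cscale (of_nat n) u"
proof -
  obtain M where M: "u \<in> fock (window M (int N) r)" using stage_space_window[OF assms] .
  have "stage_act r N (1\<^sub>m r) u = lin_ext (\<lambda>S. cscale (of_nat n) (Poly_Mapping.single S 1)) u"
    unfolding stage_act_one_lin_ext[OF M]
    by (rule lin_ext_cong) (use assms in \<open>auto simp: stage_space_def free_span_def simp del: cscale_single\<close>)
  then show ?thesis by (simp only: lin_ext_cscale_fun lin_ext_basis_id)
qed

definition L_space :: "nat \<Rightarrow> int \<Rightarrow> semi set" where
  "L_space r n = {f\<in>semi_space r. semi_act r (1\<^sub>m r) f = cscale (of_int n) f}"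

lemma fill_sea_L_space:
  assumes "u \<in> stage_space r N (n + N * r)"
  shows "fill_sea r N u \<in> L_space r (int n)"
  using assms semi_act_stage[OF assms, of "1\<^sub>m r"]
  by (simp add: L_space_def fill_sea_admissible stage_act_one_stage_space fill_sea_linear)

lemma lookup_lin_ext_diagonal:
  "Poly_Mapping.lookup (lin_ext (\<lambda>S. cscale (c S) (Poly_Mapping.single S 1)) u) S = c S * Poly_Mapping.lookup u S"
  by (simp add: lin_ext_def lookup_sum lookup_single when_def in_keys_iff if_distrib sum.delta cong: if_cong)

text \<open>
  Choose \<open>B\<close> such that all monomials of \<open>f\<close> agree with the vacuum in degrees below \<open>-B\<close> and from \<open>B\<close> on. At
  stage \<open>N = 3B\<close> the full rows contribute at least \<open>2 (N - B) = N + B\<close> factors, as many as the degrees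
  between \<open>-B\<close> and \<open>N\<close>, and so every monomial of \<open>f\<close> dominates the generator.
\<close>

lemma L_space_exhausted:
  assumes r: "r \<ge> 2" and f: "f \<in> L_space r (int n)"
  shows "\<exists>N. f \<in> fill_sea r N ` stage_carrier r N (n + N * r)"
proof -
  define D where "D = (\<Union>H\<in>Poly_Mapping.keys f. sym_diff H ({0..} \<times> {..<r}))"
  have adm: "semi_admissible r H" if "H \<in> Poly_Mapping.keys f" for H
    using f that by (auto simp: L_space_def semi_space_def)
  then have "finite D" by (auto simp: D_def semi_admissible_def)
  define B where "B = (\<Sum>p\<in>D. nat \<bar>fst p\<bar>) + 1"
  have B: "\<bar>fst p\<bar> < int B" if "p \<in> D" for p
  proof -
    have "nat \<bar>fst p\<bar> \<le> (\<Sum>p\<in>D. nat \<bar>fst p\<bar>)"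
      using \<open>finite D\<close> that by (intro member_le_sum) auto
    then have "nat \<bar>fst p\<bar> < B" by (simp add: B_def)
    then show ?thesis by linarith
  qed
  define N where "N = 3 * B"
  have H: "sea r B \<subseteq> H" "\<And>p. p \<in> H \<Longrightarrow> - int B \<le> fst p" "H \<subseteq> UNIV \<times> {..<r}"
    if "H \<in> Poly_Mapping.keys f" for H
  proof -
    have in_D: "p \<in> D" if "p \<in> H \<longleftrightarrow> p \<notin> {0..} \<times> {..<r}" for p
      using that \<open>H \<in> _\<close> by (auto simp: D_def)
    show "sea r B \<subseteq> H"
    proof
      fix p assume p: "p \<in> sea r B"
      show "p \<in> H"
      proof (rule ccontr)
        assume "p \<notin> H"
        then have "p \<in> D" using p by (intro in_D) (auto simp: sea_def)
        then show False using B[of p] p by (auto simp: sea_def)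
      qed
    qed
    show "- int B \<le> fst p" if "p \<in> H" for p
    proof (rule ccontr)
      assume "\<not> - int B \<le> fst p"
      moreover from this have "p \<in> D" using that by (intro in_D) auto
      ultimately show False using B[of p] by auto
    qed
    show "H \<subseteq> UNIV \<times> {..<r}" using adm[OF that] by (simp add: semi_admissible_def)
  qed
  let ?W = "window (- int B) (int N) r"
  define u where "u = lin_ext (\<lambda>H. Poly_Mapping.single (H - sea r N) 1) f"
  let ?Q = "(\<lambda>H. H - sea r N) ` Poly_Mapping.keys f"
  have u_Q: "u \<in> free_span ?Q"
    unfolding u_def by (auto intro!: free_span_lin free_span_single)
  have Q_W: "S \<subseteq> ?W" if "S \<in> ?Q" for S
    using that H(2,3) by (fastforce simp: sea_def window_def)
  have u_W: "u \<in> fock ?W"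
    using u_Q Q_W by (auto simp: free_span_def)
  have u_f: "fill_sea r N u = f"
  proof -
    have "sea r N \<subseteq> H" if "H \<in> Poly_Mapping.keys f" for H
      using H(1)[OF that] by (auto simp: sea_def N_def)
    then have "fill_sea r N u = lin_ext (\<lambda>H. Poly_Mapping.single H 1) f"
      unfolding fill_sea_def u_def lin_ext_compose
      by (intro lin_ext_cong) (simp add: Un_absorb2)
    then show ?thesis by (simp add: lin_ext_basis_id)
  qed
  have "fill_sea r N (stage_act r N (1\<^sub>m r) u) = fill_sea r N (cscale (of_nat n) u)"
    using f semi_act_fill_sea[OF u_W one_carrier_mat] by (simp add: u_f fill_sea_linear L_space_def)
  then have "stage_act r N (1\<^sub>m r) u = cscale (of_nat n) u"
    by (rule inj_onD[OF inj_on_fill_sea[of r N]])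
      (rule subsetD[OF fock_window_below], rule stage_act_fock[OF u_W one_carrier_mat],
       rule subsetD[OF fock_window_below], rule free_span_cscale[OF u_W])
  then have eq: "lin_ext (\<lambda>S. cscale (of_nat (card S) - of_nat (N * r)) (Poly_Mapping.single S 1)) u = cscale (of_nat n) u"
    using stage_act_one_lin_ext[OF u_W] by simp
  have card: "card S = n + N * r" if "S \<in> Poly_Mapping.keys u" for S
  proof -
    have "(of_nat (card S) - of_nat (N * r)) * Poly_Mapping.lookup u S = of_nat n * Poly_Mapping.lookup u S"
      using arg_cong[OF eq, of "\<lambda>g. Poly_Mapping.lookup g S"] unfolding lookup_lin_ext_diagonal by simp
    then have "of_nat (card S) - of_nat (N * r) = (of_nat n :: complex)"
      using that by (simp add: in_keys_iff)
    then have "(of_nat (card S) :: complex) = of_nat (n + N * r)"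
      by (simp add: algebra_simps)
    then show ?thesis by (simp only: of_nat_eq_iff)
  qed
  have "Poly_Mapping.single S 1 \<in> stage_carrier r N (n + N * r)" if S: "S \<in> Poly_Mapping.keys u" for S
  proof (rule stage_carrier_dominating)
    have SQ: "S \<in> ?Q" using u_Q S by (auto simp: free_span_def)
    then show "finite S" "S \<subseteq> below r N"
      using Q_W[OF SQ] finite_subset[OF _ finite_window] window_subset_below by blast+
    show "dominated (generator_set N (n + N * r)) S"
    proof (rule generator_set_dominated)
      show "- int B \<le> fst p" if "p \<in> S" for p using SQ that H(2) by blast
      show "{int B..<int N} \<times> {..<r} \<subseteq> S" using SQ H(1) by (fastforce simp: sea_def)
      have "2 * (int N - int B) \<le> int r * (int N - int B)"
        using r by (intro mult_right_mono) (auto simp: N_def)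
      then show "int N - - int B \<le> int r * (int N - int B)" by (simp add: N_def)
    qed (use r card[OF S] \<open>finite S\<close> in auto)
  qed (use r card[OF S] in auto)
  then have "lin_ext (\<lambda>S. Poly_Mapping.single S 1) u \<in> stage_carrier r N (n + N * r)"
    unfolding lin_ext_def
    by (intro pm.subspace_sum[OF subspace_stage_carrier] pm.subspace_scale[OF subspace_stage_carrier])
  then show ?thesis using u_f by (auto simp: lin_ext_basis_id)
qed

text \<open>
  Each vector of \<open>\<L>\<^sub>n\<close> comes from a stage, where the relations hold, and \<open>fill_sea\<close> intertwines the
  actions.
\<close>

lemma is_gr_module_L:
  assumes r: "r \<ge> 2"
  shows "is_gr_module r (L_module r (int n))"
  unfolding L_module_def L_space_def[symmetric]
proof (rule is_gr_module_free)
  show "pm.subspace (L_space r (int n))"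
  proof -
    have "semi_space r = free_span {H. semi_admissible r H}"
      by (auto simp: semi_space_def free_span_def)
    then show ?thesis
      by (auto simp: L_space_def pm.subspace_def semi_act_lin lin_ext_add lin_ext_cscale free_span_add free_span_cscale
          pm.scale_right_distrib pm.scale_left_commute mult.commute)
  qed
  have rep: "\<exists>N u M. u \<in> stage_space r N (n + N * r) \<and> u \<in> fock (window M (int N) r) \<and> v = fill_sea r N u"
    if vL: "v \<in> L_space r (int n)" for v
  proof -
    obtain N u where u: "u \<in> stage_carrier r N (n + N * r)" "v = fill_sea r N u"
      using L_space_exhausted[OF r vL] by blast
    then have "u \<in> stage_space r N (n + N * r)"
      using stage_carrier_subset[of r] r by auto
    moreover obtain M where "u \<in> fock (window M (int N) r)"
      using stage_space_window calculation by blast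
    ultimately show ?thesis using u by blast
  qed
  fix a v assume a: "a \<in> gr_carrier r" and v: "v \<in> L_space r (int n)"
  obtain N u M where u: "u \<in> stage_space r N (n + N * r)" "u \<in> fock (window M (int N) r)" "v = fill_sea r N u"
    using rep[OF v] by blast
  show "semi_act r a v \<in> L_space r (int n)"
    using semi_act_stage[OF u(1) a] fill_sea_L_space[OF stage_act_stage_space(2)[OF u(1) a]] by (simp add: u(3))
  show "semi_act r (xy_const c \<cdot>\<^sub>m a) v = cscale c (semi_act r a v)" for c
    using a u by (simp add: semi_act_stage stage_act_gr(2) fill_sea_linear)
  fix b assume b: "b \<in> gr_carrier r"
  show "semi_act r (a + b) v = semi_act r a v + semi_act r b v"
    using a b u by (simp add: semi_act_stage stage_act_gr(1) fill_sea_linear)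
  show "semi_act r (gr_bracket a b) v = semi_act r a (semi_act r b v) - semi_act r b (semi_act r a v)"
    using a b u semi_act_stage[OF stage_act_stage_space(2)[OF u(1)]]
    by (simp add: semi_act_stage gr_bracket_closed stage_act_gr(3) fill_sea_linear)
qed (simp_all add: semi_act_lin lin_ext_add lin_ext_cscale)

section \<open>The inductive system and its limit\<close>

lemma V_system_free:
  "V_system r n N = free_gr_module (stage_carrier r N (n + N * r)) (stage_act r N)"
  by (simp add: V_system_def tensor_delta_def V_module_def free_gr_module_def stage_carrier_def stage_act_def fun_eq_iff)

lemma V_system_inductive:
  assumes r: "r > 0"
  shows "inductive_system r (V_system r n) (V_embed r)"
proof -
  have sub: "u \<in> stage_space r N m" if "u \<in> stage_carrier r N m" for u N m
    using stage_carrier_subset[OF r] that by blast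
  have closed: "stage_act r N a v \<in> stage_carrier r N m" if "a \<in> gr_carrier r" "v \<in> stage_carrier r N m" for a v N m
    unfolding stage_act_def using that
    by (intro pm.subspace_add[OF subspace_stage_carrier] pm.subspace_scale[OF subspace_stage_carrier] stage_carrier_act)
  have mod: "is_gr_module r (V_system r n N)" for N
    unfolding V_system_free
  proof (rule is_gr_module_free[OF subspace_stage_carrier closed])
    fix a v assume a: "a \<in> gr_carrier r" and v: "v \<in> stage_carrier r N (n + N * r)"
    obtain M where M: "v \<in> fock (window M (int N) r)" using stage_space_window[OF sub[OF v]] .
    show "stage_act r N (xy_const c \<cdot>\<^sub>m a) v = cscale c (stage_act r N a v)" for c
      using stage_act_gr(2)[OF M a a] .
    fix b assume b: "b \<in> gr_carrier r"
    show "stage_act r N (a + b) v = stage_act r N a v + stage_act r N b v"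
      and "stage_act r N (gr_bracket a b) v = stage_act r N a (stage_act r N b v) - stage_act r N b (stage_act r N a v)"
      using stage_act_gr[OF M a b] by auto
  qed (simp_all add: stage_act_linear)
  have m: "n + N * r + r = n + Suc N * r" for N by simp
  have "V_embed r N \<in> gr_hom r (V_system r n N) (V_system r n (Suc N))" for N
    using V_embed_stage_carrier[OF r, of _ N "n + N * r"] V_embed_stage_act[OF sub]
    unfolding gr_hom_def V_system_free m by (auto simp: free_gr_module_def V_embed_linear)
  moreover have "inj_on (V_embed r N) (carrier (V_system r n N))" for N
  proof (rule inj_onI)
    fix u v assume uv: "u \<in> carrier (V_system r n N)" "v \<in> carrier (V_system r n N)" "V_embed r N u = V_embed r N v"
    then have s: "u \<in> stage_space r N (n + N * r)" "v \<in> stage_space r N (n + N * r)"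
      by (auto simp: V_system_free free_gr_module_def intro: sub)
    then have "fill_sea r N u = fill_sea r N v" using uv(3) fill_sea_V_embed by metis
    then show "u = v" using s inj_on_fill_sea_stage by (metis inj_onD)
  qed
  ultimately show ?thesis using mod by (simp add: inductive_system_def)
qed

theorem proposition18:
  fixes r n :: nat
  assumes "r \<ge> 2"
  shows "inductive_system r (V_system r n) (V_embed r) \<and>
    gr_isomorphic r (direct_limit (V_system r n) (V_embed r)) (L_module r (int n))"
proof
  have r: "r > 0" using assms by simp
  show sys: "inductive_system r (V_system r n) (V_embed r)" using r by (rule V_system_inductive)
  have stage: "u \<in> stage_space r N (n + N * r)" if "u \<in> carrier (V_system r n N)" for u N
    using stage_carrier_subset[OF r] that by (auto simp: V_system_free free_gr_module_def)
  have L: "carrier (L_module r (int n)) = L_space r (int n)"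
    by (simp add: L_module_def L_space_def free_gr_module_def)
  show "gr_isomorphic r (direct_limit (V_system r n) (V_embed r)) (L_module r (int n))"
  proof (rule direct_limit_isomorphic[OF sys is_gr_module_L[OF assms], where \<iota> = "fill_sea r"])
    fix N
    show "fill_sea r N \<in> gr_hom r (V_system r n N) (L_module r (int n))"
      unfolding gr_hom_def L using stage[of _ N] fill_sea_L_space[of _ r N n] semi_act_stage[of _ r N "n + N * r"]
      by (auto simp: V_system_free L_module_def free_gr_module_def fill_sea_linear)
    show "inj_on (fill_sea r N) (carrier (V_system r n N))"
      by (rule inj_on_subset[OF inj_on_fill_sea_stage]) (use stage in blast)
    show "fill_sea r (Suc N) (V_embed r N v) = fill_sea r N v" if "v \<in> carrier (V_system r n N)" for v
      using fill_sea_V_embed stage[OF that] .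
  next
    fix f assume "f \<in> carrier (L_module r (int n))"
    then show "\<exists>N. f \<in> fill_sea r N ` carrier (V_system r n N)"
      using L_space_exhausted[OF assms] by (auto simp: L V_system_free free_gr_module_def)
  qed
qed

end
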